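(* Let $f : \mathbb{R} \to [0,\infty)$ be a non-decreasing function such that the Laplace transform $$F(s) = \int_{0}^{\infty} f(u) e^{-su}\, du$$ converges absolutely for $\mathrm{Re}(s) > 1$. Let $r$ be a non-negative integer, let $\alpha \in \mathbb{R}_{>0}$ and $\alpha_i \in \mathbb{R}_{>0}$ for $i = 1, \dots, r$, let $A \in \mathbb{R}_{>0}$ and $A_i \in \mathbb{C}$ for $i=1,\dots,r$, and assume $\alpha > \alpha_i$ for all $i$. Define, for $\mathrm{Re}(s) > 1$, $$G(s) = F(s) - \frac{A}{(s-1)^{\alpha}} - \sum_{i=1}^{r} \frac{A_i}{(s-1)^{\alpha_i}}.$$ Suppose that $G$ extends continuously to the closed half-plane $\{s \in \mathbb{C} : \mathrm{Re}(s) \ge 1\}$. If $\alpha < 1$, assume in addition that, once so extended, the function $t \mapsto G(1+it)$ ($t\in\mathbb{R}$) is locally of bounded variation. Then $$\lim_{u \to \infty} u^{1-\alpha} e^{-u} f(u) = \frac{A}{\Gamma(\alpha)}.$$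
   Context: For $\beta \in \mathbb{R}$ and $x \in \mathbb{C}$, $(s-x)^{\beta} := \exp(\beta \log(s-x))$ for $s-x \notin (-\infty,0]$, where $\log$ is the principal branch with argument in $(-\pi,\pi)$; thus $(s-x)^\beta$ is positive real when $s-x>0$. For $f:[a,b]\to\mathbb{R}$, $V_a^b f$ is the supremum over all partitions $a=x_0<x_1<\dots<x_n=b$ of $\sum_{i=1}^n |f(x_i)-f(x_{i-1})|$; $f$ is of bounded variation if $V_a^b f<\infty$. A function $[a,b]\to\mathbb{C}$ is of bounded variation if its real and imaginary parts are, and a function $\mathbb{R}\to\mathbb{C}$ is locally of bounded variation if it is of bounded variation on every closed interval $[a,b]$. *)

theory Defs
  imports "HOL-Analysis.Analysis"
begin

(* A partition with n pieces is coded by a sequence of which only x 0, ..., x n matter.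
   For a = b the trivial partition n = 0 is the only one. *)
definition partitions :: "real \<Rightarrow> real \<Rightarrow> (nat \<times> (nat \<Rightarrow> real)) set" where
  "partitions a b = {(n, x). x 0 = a \<and> x n = b \<and> (\<forall>i\<in>{1..n}. x (i - 1) < x i)}"

definition total_variation :: "real \<Rightarrow> real \<Rightarrow> (real \<Rightarrow> real) \<Rightarrow> ennreal" where
  "total_variation a b f =
     (SUP (n, x)\<in>partitions a b. ennreal (\<Sum>i=1..n. \<bar>f (x i) - f (x (i - 1))\<bar>))"

definition bounded_variation :: "real \<Rightarrow> real \<Rightarrow> (real \<Rightarrow> real) \<Rightarrow> bool" where
  "bounded_variation a b f \<longleftrightarrow> total_variation a b f < \<infinity>"

definition complex_bounded_variation :: "real \<Rightarrow> real \<Rightarrow> (real \<Rightarrow> complex) \<Rightarrow> bool" where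
  "complex_bounded_variation a b g \<longleftrightarrow>
     bounded_variation a b (\<lambda>t. Re (g t)) \<and> bounded_variation a b (\<lambda>t. Im (g t))"

definition locally_bounded_variation :: "(real \<Rightarrow> complex) \<Rightarrow> bool" where
  "locally_bounded_variation g \<longleftrightarrow> (\<forall>a b. a \<le> b \<longrightarrow> complex_bounded_variation a b g)"

(* Integrability in the sense of Lebesgue, hence absolute convergence of the integral. *)
definition laplace_abs_convergent :: "(real \<Rightarrow> real) \<Rightarrow> complex \<Rightarrow> bool" where
  "laplace_abs_convergent f s \<longleftrightarrow>
     set_integrable lborel {0..} (\<lambda>u. complex_of_real (f u) * exp (- s * complex_of_real u))"

definition laplace_transform :: "(real \<Rightarrow> real) \<Rightarrow> complex \<Rightarrow> complex" where
  "laplace_transform f s =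
     (LINT u:{0..}|lborel. complex_of_real (f u) * exp (- s * complex_of_real u))"

end

theory Submission
  imports Defs "HOL-Probability.Probability"
begin

text \<open>
  Put \<open>w u = f u * exp (- u)\<close> for \<open>u \<ge> 0\<close>. Since \<open>\<Gamma>(\<beta>) / z powr \<beta>\<close> is the Laplace transform of
  \<open>u powr (\<beta> - 1)\<close>, the function \<open>G (1 + z)\<close> is the Laplace transform of \<open>w - h\<close>, where \<open>h\<close> is
  \<open>A / \<Gamma>(\<alpha>) * u powr (\<alpha> - 1)\<close> plus lower powers. Smooth with the nonnegative kernel
  \<open>K v = sinc (l * v) ^ m\<close>, which is the characteristic function of a compactly supported measure
  \<open>\<nu>\<close> and decays fast for large even \<open>m\<close>. Fubini's theorem and monotone convergence as
  \<open>Re z \<rightarrow> 0\<close> give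
  \<open>\<integral> w u * K (x - u) du = \<integral> h u * K (x - u) du + \<integral> exp (i x t) * G (1 + i t) d\<nu>(t)\<close>.
  Relative to \<open>x powr (\<alpha> - 1)\<close>, the first term on the right tends to \<open>A / \<Gamma>(\<alpha>) * \<integral> K\<close>. The second
  is negligible: by the Riemann-Lebesgue lemma if \<open>\<alpha> \<ge> 1\<close>, and because bounded variation makes it
  \<open>O (1 / x)\<close> if \<open>\<alpha> < 1\<close>. As \<open>l\<close> grows, \<open>K\<close> concentrates at \<open>0\<close>, and the monotonicity of \<open>f\<close>
  turns the asymptotics of the averages into those of \<open>w\<close>.
\<close>

section \<open>Laplace transforms of powers\<close>

lemma has_bochner_integral_Gamma_scaled:
  fixes \<beta> c :: real
  assumes "0 < \<beta>" "0 < c"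
  shows "has_bochner_integral lborel
    (\<lambda>u. indicator {0..} u * u powr (\<beta> - 1) * exp (- (c * u))) (Gamma \<beta> / c powr \<beta>)"
proof -
  have 1: "has_bochner_integral lborel (\<lambda>t. indicator {0..} t * t powr (\<beta> - 1) / exp t) (Gamma \<beta>)"
  proof (rule has_bochner_integral_nn_integral)
    show "(\<integral>\<^sup>+ t. ennreal (indicator {0..} t * t powr (\<beta> - 1) / exp t) \<partial>lborel) = ennreal (Gamma \<beta>)"
      using Gamma_conv_nn_integral_real[OF assms(1)] by simp
  qed (use Gamma_real_pos[OF assms(1)] in auto)
  have 2: "has_bochner_integral lborel (\<lambda>u. indicator {0..} (0 + c * u) * (0 + c * u) powr (\<beta> - 1) / exp (0 + c * u))
      (Gamma \<beta> /\<^sub>R \<bar>c\<bar>)"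
    using 1 assms(2) lborel_has_bochner_integral_real_affine_iff[of c "(\<lambda>t. indicator {0..} t * t powr (\<beta> - 1) / exp t)"
        "Gamma \<beta>" 0] by simp
  have 3: "has_bochner_integral lborel (\<lambda>u. c powr (1 - \<beta>) *
      (indicator {0..} (0 + c * u) * (0 + c * u) powr (\<beta> - 1) / exp (0 + c * u)))
      (c powr (1 - \<beta>) * (Gamma \<beta> /\<^sub>R \<bar>c\<bar>))"
    by (rule has_bochner_integral_mult_right) (use 2 in auto)
  have 4: "c powr (1 - \<beta>) * (Gamma \<beta> /\<^sub>R \<bar>c\<bar>) = Gamma \<beta> / c powr \<beta>"
    using assms by (simp add: powr_diff field_simps)
  have 5: "c powr (1 - \<beta>) * (indicator {0..} (0 + c * u) * (0 + c * u) powr (\<beta> - 1) / exp (0 + c * u))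
     = indicator {0..} u * u powr (\<beta> - 1) * exp (- (c * u))" for u
  proof (cases "u \<ge> 0")
    case True
    have "c powr (1 - \<beta>) * (c * u) powr (\<beta> - 1) = u powr (\<beta> - 1)"
      using assms True by (simp add: powr_mult flip: powr_add mult.assoc)
    then show ?thesis using True assms by (simp add: exp_minus field_simps)
  next
    case False
    then have "\<not> 0 \<le> c * u" using assms by (simp add: zero_le_mult_iff)
    then show ?thesis using False by simp
  qed
  show ?thesis using 3 unfolding 4 5 .
qed

text \<open>The integrand is expanded around a real point \<open>c\<close> so large that
  \<open>\<bar>z - c\<bar> < c\<close>; the resulting series is the binomial series of \<open>z powr (- \<beta>)\<close>.\<close>

lemma has_bochner_integral_laplace_powr:
  fixes \<beta> :: real and z :: complex
  assumes "0 < \<beta>" "0 < Re z"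
  shows "has_bochner_integral lborel
    (\<lambda>u. complex_of_real (indicator {0..} u * u powr (\<beta> - 1)) * exp (- (z * of_real u)))
    (Gamma \<beta> / z powr \<beta>)"
proof -
  \<comment> \<open>\<open>c\<close> solves \<open>c * Re z = (cmod z)^2\<close>, so that
    \<open>(cmod (z - c))^2 = c^2 - (cmod z)^2\<close>: the point \<open>z\<close> lies in the open
    disc of radius \<open>c\<close> around \<open>c\<close>.\<close>
  define c where "c = (cmod z)\<^sup>2 / Re z"
  have "z \<noteq> 0" using assms(2) by auto
  then have c0: "0 < c" using assms(2) by (simp add: c_def)
  define w where "w = z - of_real c"
  have wc: "cmod w < c"
  proof -
    have "(cmod w)\<^sup>2 = (cmod z)\<^sup>2 - 2 * c * Re z + c\<^sup>2"
      unfolding w_def cmod_power2 by (simp add: power2_eq_square algebra_simps)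
    also have "\<dots> < c\<^sup>2" using assms by (auto simp: c_def)
    finally show ?thesis using c0 by (simp add: power2_less_imp_less)
  qed
  define q where "q = cmod w / c"
  have q: "0 \<le> q" "q < 1" using wc c0 by (auto simp: q_def)
  define g where "g n u = indicator {0..} u * u powr (\<beta> + real n - 1) * exp (- (c * u))" for n and u :: real
  have g_int: "has_bochner_integral lborel (g n) (Gamma (\<beta> + real n) / c powr (\<beta> + real n))" for n
    unfolding g_def by (rule has_bochner_integral_Gamma_scaled) (use assms c0 in auto)
  have poch: "Gamma (\<beta> + real n) = Gamma \<beta> * pochhammer \<beta> n" for n
  proof -
    have "\<beta> \<notin> \<int>\<^sub>\<le>\<^sub>0" using assms by (auto elim!: nonpos_Ints_cases)
    moreover have "Gamma \<beta> \<noteq> 0" using Gamma_real_pos[OF assms(1)] by simp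
    ultimately show ?thesis by (simp add: pochhammer_Gamma)
  qed
  have cpow: "c powr (\<beta> + real n) = c powr \<beta> * c ^ n" for n
    using c0 by (simp add: powr_add powr_realpow)
  have gpow: "g n u = g 0 u * u ^ n" for n u
  proof (cases "u > 0")
    case True
    then show ?thesis by (simp add: g_def powr_add powr_diff powr_realpow)
  next
    case False
    then show ?thesis by (cases "u = 0") (auto simp: g_def indicator_def)
  qed
  \<comment> \<open>\<open>F n\<close> is the term of degree \<open>n\<close> in the series of
    \<open>exp (- w * u)\<close>, times the integrand \<open>g 0\<close> at the real point
    \<open>c\<close>; its integral is a Gamma value.\<close>
  define F where "F n u = complex_of_real (g n u) * ((- w) ^ n / fact n)" for n u
  have F_int: "has_bochner_integral lborel (F n)
     (complex_of_real (Gamma (\<beta> + real n) / c powr (\<beta> + real n)) * ((- w) ^ n / fact n))" for n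
    unfolding F_def by (intro has_bochner_integral_mult_left has_bochner_integral_of_real g_int)
  have F_sums: "(\<lambda>n. F n u) sums (complex_of_real (indicator {0..} u * u powr (\<beta> - 1)) * exp (- (z * of_real u)))"
    and F_summable: "summable (\<lambda>n. norm (F n u))" for u
  proof -
    have Fe: "F n u = complex_of_real (g 0 u) * ((- w * of_real u) ^ n /\<^sub>R fact n)" for n
      unfolding F_def gpow[of n] by (simp add: scaleR_conv_of_real field_simps power_mult_distrib power_minus')
    have "(\<lambda>n. F n u) sums (complex_of_real (g 0 u) * exp (- w * of_real u))"
      unfolding Fe by (intro sums_mult exp_converges)
    also have "complex_of_real (g 0 u) * exp (- w * of_real u) =
        complex_of_real (indicator {0..} u * u powr (\<beta> - 1)) * exp (- (z * of_real u))"
      by (simp add: g_def w_def exp_of_real mult.assoc algebra_simps flip: exp_add exp_of_real)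
    finally show "(\<lambda>n. F n u) sums \<dots>" .
    have "summable (\<lambda>n. norm ((- w * of_real u) ^ n /\<^sub>R fact n))"
      by (rule summable_norm_exp)
    then have "summable (\<lambda>n. norm (complex_of_real (g 0 u)) * norm ((- w * of_real u) ^ n /\<^sub>R fact n))"
      by (rule summable_mult)
    then show "summable (\<lambda>n. norm (F n u))" unfolding Fe norm_mult .
  qed
  \<comment> \<open>Taking norms replaces \<open>w / c\<close> by \<open>- q\<close>: all terms
    become nonnegative and form the binomial series at \<open>- q\<close>. It converges because
    \<open>q < 1\<close>, which justifies exchanging sum and integral.\<close>
  have norm_int: "(\<integral>u. norm (F n u) \<partial>lborel) = Gamma \<beta> / c powr \<beta> * ((- \<beta> gchoose n) * (- q) ^ n)" for n
  proof -
    have "norm (F n u) = g n u * (cmod w ^ n / fact n)" for u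
      by (simp add: F_def norm_mult norm_divide norm_power g_def)
    then have "(\<integral>u. norm (F n u) \<partial>lborel) = Gamma (\<beta> + real n) / c powr (\<beta> + real n) * (cmod w ^ n / fact n)"
      using has_bochner_integral_integral_eq[OF g_int[of n]] by simp
    also have "\<dots> = Gamma \<beta> / c powr \<beta> * ((- \<beta> gchoose n) * (- q) ^ n)"
      by (simp add: poch cpow gbinomial_pochhammer q_def power_divide power_minus[of "_ / _"] field_simps flip: power_mult_distrib)
    finally show ?thesis .
  qed
  have summ: "summable (\<lambda>n. \<integral>u. norm (F n u) \<partial>lborel)"
    unfolding norm_int by (intro summable_mult sums_summable[OF gen_binomial_real]) (use q in auto)
  have int: "integrable lborel (\<lambda>u. \<Sum>n. F n u)"
    and s1: "(\<lambda>n. integral\<^sup>L lborel (F n)) sums (\<integral>u. (\<Sum>n. F n u) \<partial>lborel)"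
    using integrable_suminf[of lborel F] sums_integral[of lborel F] summ F_summable F_int
    by (auto simp: has_bochner_integral_iff)
  have Fi: "integral\<^sup>L lborel (F n) = Gamma \<beta> / c powr \<beta> * ((- complex_of_real \<beta> gchoose n) * (w / c) ^ n)" for n
  proof -
    have "integral\<^sup>L lborel (F n) = complex_of_real (Gamma (\<beta> + real n) / c powr (\<beta> + real n)) * ((- w) ^ n / fact n)"
      by (rule has_bochner_integral_integral_eq[OF F_int])
    also have "complex_of_real (Gamma (\<beta> + real n) / c powr (\<beta> + real n)) = Gamma \<beta> / c powr \<beta> * pochhammer (complex_of_real \<beta>) n / c ^ n"
      by (simp add: poch cpow pochhammer_of_real)
    also have "\<dots> * ((- w) ^ n / fact n) = Gamma \<beta> / c powr \<beta> * ((- complex_of_real \<beta> gchoose n) * (w / c) ^ n)"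
      by (simp add: gbinomial_pochhammer power_divide power_minus[of w] field_simps)
    finally show ?thesis .
  qed
  have "(\<lambda>n. integral\<^sup>L lborel (F n)) sums (Gamma \<beta> / c powr \<beta> * (1 + w / c) powr (- complex_of_real \<beta>))"
    unfolding Fi by (intro sums_mult gen_binomial_complex) (use wc c0 in \<open>auto simp: norm_divide\<close>)
  with s1 have "(\<integral>u. (\<Sum>n. F n u) \<partial>lborel) = Gamma \<beta> / c powr \<beta> * (1 + w / c) powr (- complex_of_real \<beta>)"
    by (rule sums_unique2)
  also have "\<dots> = Gamma \<beta> / z powr \<beta>"
  proof -
    \<comment> \<open>Splitting off a positive real factor does not cross the branch cut, so the
      power is multiplicative here.\<close>
    have z: "z = of_real c * (1 + w / c)" using c0 by (simp add: w_def field_simps)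
    have "z powr \<beta> = of_real c powr of_real \<beta> * (1 + w / c) powr \<beta>"
      by (subst z, rule powr_times_real_left) (use c0 in auto)
    then show ?thesis using c0 by (simp add: powr_minus powr_of_real field_simps)
  qed
  finally have "(\<integral>u. (\<Sum>n. F n u) \<partial>lborel) = Gamma \<beta> / z powr \<beta>" .
  moreover have "(\<Sum>n. F n u) = complex_of_real (indicator {0..} u * u powr (\<beta> - 1)) * exp (- (z * of_real u))" for u
    using F_sums by (simp add: sums_iff)
  ultimately show ?thesis using int by (simp add: has_bochner_integral_iff)
qed

section \<open>Smoothing powers\<close>

lemma integrable_inverse_one_plus_abs_square: "integrable lborel (\<lambda>v::real. (1 + \<bar>v\<bar>) powr - 2)"
proof (rule Bochner_Integration.integrable_bound)
  show "integrable lborel (\<lambda>v::real. inverse (1 + v\<^sup>2))"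
    using integrable_inverse_1_plus_square by (simp add: set_integrable_def einterval_def)
  show "AE v in lborel. norm ((1 + \<bar>v :: real\<bar>) powr - 2) \<le> norm (inverse (1 + v\<^sup>2))"
  proof (rule AE_I2)
    fix v :: real
    have "(1 + \<bar>v\<bar>) powr - 2 = inverse ((1 + \<bar>v\<bar>)\<^sup>2)"
      by (subst powr_minus) (simp add: powr_realpow)
    also have "\<dots> \<le> inverse (1 + v\<^sup>2)"
      by (intro le_imp_inverse_le) (auto simp: power2_eq_square algebra_simps add_pos_nonneg)
    finally show "norm ((1 + \<bar>v\<bar>) powr - 2) \<le> norm (inverse (1 + v\<^sup>2))" by simp
  qed
qed measurable

lemma integrable_of_decay:
  fixes K :: "real \<Rightarrow> real"
  assumes [measurable]: "K \<in> borel_measurable borel"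
    and decay: "\<And>v. \<bar>K v\<bar> \<le> C * (1 + \<bar>v\<bar>) powr - N" and "2 \<le> N"
  shows "integrable lborel K"
proof (rule Bochner_Integration.integrable_bound)
  show "integrable lborel (\<lambda>v. \<bar>C\<bar> * (1 + \<bar>v\<bar>) powr - 2)"
    by (intro integrable_mult_right integrable_inverse_one_plus_abs_square)
  show "AE v in lborel. norm (K v) \<le> norm (\<bar>C\<bar> * (1 + \<bar>v\<bar>) powr - 2)"
  proof (rule AE_I2)
    fix v
    have "\<bar>K v\<bar> \<le> \<bar>C\<bar> * (1 + \<bar>v\<bar>) powr - N"
      by (rule order_trans[OF decay]) (intro mult_right_mono, auto)
    also have "\<dots> \<le> \<bar>C\<bar> * (1 + \<bar>v\<bar>) powr - 2"
      using assms(3) by (intro mult_left_mono powr_mono) auto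
    finally show "norm (K v) \<le> norm (\<bar>C\<bar> * (1 + \<bar>v\<bar>) powr - 2)" by simp
  qed
qed simp

text \<open>A Peetre-type inequality: since \<open>1 \<le> x\<close>,
  \<open>u \<le> x + |x - u| \<le> x * (1 + |x - u|)\<close>, and exchanging \<open>u\<close> and
  \<open>x\<close> serves negative \<open>p\<close>. It trades the growth of a power for a loss of
  \<open>|p|\<close> in the decay of the kernel, uniformly in \<open>x\<close>.\<close>

lemma powr_quotient_le:
  fixes u x p :: real
  assumes "1 \<le> u" "1 \<le> x"
  shows "(u / x) powr p \<le> (1 + \<bar>x - u\<bar>) powr \<bar>p\<bar>"
proof (cases "p \<ge> 0")
  case True
  have "u / x \<le> 1 + \<bar>x - u\<bar>"
  proof -
    have "u \<le> x + \<bar>x - u\<bar> * 1" by simp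
    also have "\<dots> \<le> x + \<bar>x - u\<bar> * x" using assms by (intro add_left_mono mult_left_mono) auto
    finally show ?thesis using assms by (simp add: field_simps)
  qed
  then show ?thesis using True assms by (simp add: powr_mono2)
next
  case False
  have "x / u \<le> 1 + \<bar>x - u\<bar>"
  proof -
    have "x \<le> u + \<bar>x - u\<bar> * 1" by simp
    also have "\<dots> \<le> u + \<bar>x - u\<bar> * u" using assms by (intro add_left_mono mult_left_mono) auto
    finally show ?thesis using assms by (simp add: field_simps)
  qed
  moreover have "(u / x) powr p = (x / u) powr (- p)"
    using assms by (simp add: powr_divide powr_minus field_simps)
  ultimately show ?thesis using False assms by (simp add: powr_mono2)
qed

text \<open>In the variable \<open>v = x - u\<close> the normalised integrand is
  \<open>((x - v) / x) powr (\<beta> - 1) * K v\<close>, whose first factor tends to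
  \<open>1\<close>. Dominated convergence handles \<open>1 \<le> u\<close>; the part
  \<open>u < 1\<close>, where the power may be singular, is negligible because \<open>K\<close> is
  evaluated far from its centre.\<close>

lemma
  fixes K :: "real \<Rightarrow> real" and \<beta> C N :: real
  assumes \<beta>: "0 < \<beta>" and K[measurable]: "K \<in> borel_measurable borel"
    and decay: "\<And>v. \<bar>K v\<bar> \<le> C * (1 + \<bar>v\<bar>) powr - N" and N: "\<bar>\<beta> - 1\<bar> + 2 \<le> N"
  shows integrable_powr_kernel:
      "\<And>x. 1 \<le> x \<Longrightarrow> integrable lborel (\<lambda>u. indicator {0..} u * u powr (\<beta> - 1) * K (x - u))"
    and tendsto_powr_kernel:
      "((\<lambda>x. x powr (1 - \<beta>) * (\<integral>u. indicator {0..} u * u powr (\<beta> - 1) * K (x - u) \<partial>lborel))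
        \<longlongrightarrow> integral\<^sup>L lborel K) at_top"
proof -
  have C: "0 \<le> C" using decay[of 0] by simp
  \<comment> \<open>\<open>p\<close> carries the possible singularity at \<open>0\<close>.
    \<open>s x\<close> is the rest, divided by \<open>x powr (\<beta> - 1)\<close>. \<open>W\<close>
    will dominate it: exponent \<open>- 2\<close> is what the decay \<open>N\<close> leaves after
    paying \<open>|\<beta> - 1|\<close>.\<close>
  define p where "p u = indicator {0..<1} u * u powr (\<beta> - 1)" for u :: real
  define s where "s x v = indicator {1..} (x - v) * ((x - v) / x) powr (\<beta> - 1) * K v" for x v
  define W where "W v = C * (1 + \<bar>v\<bar>) powr - 2" for v :: real
  have p_meas[measurable]: "p \<in> borel_measurable borel" unfolding p_def by measurable
  have s_meas[measurable]: "s x \<in> borel_measurable borel" for x unfolding s_def by measurable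
  have p0: "0 \<le> p u" for u by (simp add: p_def)
  have p_int: "integrable lborel p"
  proof (rule Bochner_Integration.integrable_bound)
    show "integrable lborel (\<lambda>u. exp 1 * (indicator {0..} u * u powr (\<beta> - 1) * exp (- (1 * u))))"
      using has_bochner_integral_Gamma_scaled[OF \<beta>, of 1]
      by (intro integrable_mult_right) (simp add: has_bochner_integral_iff)
    show "AE u in lborel. norm (p u) \<le> norm (exp 1 * (indicator {0..} u * u powr (\<beta> - 1) * exp (- (1 * u))))"
    proof (rule AE_I2)
      fix u :: real
      have "u powr (\<beta> - 1) * 1 \<le> u powr (\<beta> - 1) * (exp 1 * exp (- u))" if "u < 1"
        using that by (intro mult_left_mono) (auto simp flip: exp_add)
      then show "norm (p u) \<le> norm (exp 1 * (indicator {0..} u * u powr (\<beta> - 1) * exp (- (1 * u))))"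
        by (auto simp: p_def indicator_def algebra_simps)
    qed
  qed simp
  \<comment> \<open>For \<open>u < 1\<close> one has \<open>x \<le> 1 + |x - u|\<close>, so the
    decay of \<open>K\<close> yields the factor \<open>x powr - N\<close>.\<close>
  have near: "norm (p u * K (x - u)) \<le> norm (C * x powr - N * p u)" if "1 \<le> x" for x u
  proof (cases "0 \<le> u \<and> u < 1")
    case True
    have "\<bar>K (x - u)\<bar> \<le> C * (1 + \<bar>x - u\<bar>) powr - N" by (rule decay)
    also have "\<dots> \<le> C * x powr - N"
      using that True N C by (intro mult_left_mono powr_mono2') auto
    finally show ?thesis
      using p0[of u] C by (simp add: abs_mult mult.commute mult_left_mono)
  qed (auto simp: p_def)
  have near_int: "integrable lborel (\<lambda>u. p u * K (x - u))" if "1 \<le> x" for x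
    using near[OF that] by (intro Bochner_Integration.integrable_bound[OF integrable_mult_right[OF p_int]] AE_I2) auto
  have W_int: "integrable lborel W"
    unfolding W_def by (intro integrable_mult_right integrable_inverse_one_plus_abs_square)
  have far: "norm (s x v) \<le> W v" if "1 \<le> x" for x v
  proof (cases "1 \<le> x - v")
    case True
    have "norm (s x v) = ((x - v) / x) powr (\<beta> - 1) * \<bar>K v\<bar>" using True by (simp add: s_def abs_mult)
    also have "\<dots> \<le> (1 + \<bar>v\<bar>) powr \<bar>\<beta> - 1\<bar> * (C * (1 + \<bar>v\<bar>) powr - N)"
      using powr_quotient_le[OF True that, of "\<beta> - 1"] decay[of v] by (intro mult_mono) auto
    also have "\<dots> = C * (1 + \<bar>v\<bar>) powr (\<bar>\<beta> - 1\<bar> - N)"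
      by (simp add: powr_diff powr_minus field_simps)
    also have "\<dots> \<le> W v" unfolding W_def using N C by (intro mult_left_mono powr_mono) auto
    finally show ?thesis .
  qed (use C in \<open>auto simp: s_def W_def\<close>)
  have s_int: "integrable lborel (s x)" if "1 \<le> x" for x
    using far[OF that] by (intro Bochner_Integration.integrable_bound[OF W_int] AE_I2) (auto intro: order_trans[OF _ abs_ge_self])
  have split: "indicator {0..} u * u powr (\<beta> - 1) * K (x - u)
      = p u * K (x - u) + x powr (\<beta> - 1) * s x (x + (-1) * u)" if "1 \<le> x" for x u
    using that by (auto simp: p_def s_def indicator_def powr_divide)
  have s_int': "integrable lborel (\<lambda>u. s x (x + (-1) * u))" if "1 \<le> x" for x
    using lborel_integrable_real_affine[OF s_int[OF that], of "-1" x] by simp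
  show int: "integrable lborel (\<lambda>u. indicator {0..} u * u powr (\<beta> - 1) * K (x - u))" if "1 \<le> x" for x
    unfolding split[OF that]
    by (intro Bochner_Integration.integrable_add integrable_mult_right near_int s_int' that)
  have eq: "x powr (1 - \<beta>) * (\<integral>u. indicator {0..} u * u powr (\<beta> - 1) * K (x - u) \<partial>lborel)
      = x powr (1 - \<beta>) * (\<integral>u. p u * K (x - u) \<partial>lborel) + integral\<^sup>L lborel (s x)" if "1 \<le> x" for x
  proof -
    have "(\<integral>u. indicator {0..} u * u powr (\<beta> - 1) * K (x - u) \<partial>lborel)
      = (\<integral>u. p u * K (x - u) \<partial>lborel) + x powr (\<beta> - 1) * (\<integral>u. s x (x + (-1) * u) \<partial>lborel)"
      unfolding split[OF that] using near_int s_int' that by simp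
    also have "(\<integral>u. s x (x + (-1) * u) \<partial>lborel) = integral\<^sup>L lborel (s x)"
      using lborel_integral_real_affine[of "-1" "s x" x] by simp
    finally show ?thesis using that by (simp add: distrib_left flip: mult.assoc powr_add)
  qed
  have 1: "((\<lambda>x. x powr (1 - \<beta>) * (\<integral>u. p u * K (x - u) \<partial>lborel)) \<longlongrightarrow> 0) at_top"
  proof (rule Lim_null_comparison)
    show "((\<lambda>x. C * integral\<^sup>L lborel p * x powr - (N - (1 - \<beta>))) \<longlongrightarrow> 0) at_top"
      using N by (intro tendsto_mult_right_zero tendsto_neg_powr filterlim_ident) auto
    show "\<forall>\<^sub>F x in at_top. norm (x powr (1 - \<beta>) * (\<integral>u. p u * K (x - u) \<partial>lborel))
       \<le> C * integral\<^sup>L lborel p * x powr - (N - (1 - \<beta>))"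
      using eventually_ge_at_top[of 1]
    proof eventually_elim
      fix x :: real assume x: "1 \<le> x"
      have "norm (\<integral>u. p u * K (x - u) \<partial>lborel) \<le> (\<integral>u. C * x powr - N * p u \<partial>lborel)"
        by (rule Bochner_Integration.integral_norm_bound_integral)
          (use near[OF x] near_int[OF x] p_int p0 C in auto)
      then have "x powr (1 - \<beta>) * norm (\<integral>u. p u * K (x - u) \<partial>lborel)
          \<le> x powr (1 - \<beta>) * (C * x powr - N * integral\<^sup>L lborel p)"
        by (intro mult_left_mono) auto
      also have "\<dots> = C * integral\<^sup>L lborel p * x powr - (N - (1 - \<beta>))"
        by (simp add: powr_diff powr_minus powr_add field_simps)
      finally show "norm (x powr (1 - \<beta>) * (\<integral>u. p u * K (x - u) \<partial>lborel))
          \<le> C * integral\<^sup>L lborel p * x powr - (N - (1 - \<beta>))"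
        by (simp add: abs_mult)
    qed
  qed
  have 2: "((\<lambda>x. integral\<^sup>L lborel (s x)) \<longlongrightarrow> integral\<^sup>L lborel K) at_top"
  proof (rule integral_dominated_convergence_at_top[where w = W])
    show "AE v in lborel. ((\<lambda>x. s x v) \<longlongrightarrow> K v) at_top"
    proof (rule AE_I2)
      fix v
      have "((\<lambda>x. (1 - v / x) powr (\<beta> - 1) * K v) \<longlongrightarrow> (1 - 0) powr (\<beta> - 1) * K v) at_top"
        by (intro tendsto_intros real_tendsto_divide_at_top filterlim_ident) auto
      moreover have "\<forall>\<^sub>F x in at_top. s x v = (1 - v / x) powr (\<beta> - 1) * K v"
        using eventually_ge_at_top[of "1 + \<bar>v\<bar>"]
        by eventually_elim (auto simp: s_def diff_divide_distrib)
      ultimately show "((\<lambda>x. s x v) \<longlongrightarrow> K v) at_top" by (simp add: tendsto_cong)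
    qed
    show "\<forall>\<^sub>F x in at_top. AE v in lborel. norm (s x v) \<le> W v"
      using eventually_ge_at_top[of 1] by eventually_elim (use far in auto)
  qed (use W_int in auto)
  have "((\<lambda>x. x powr (1 - \<beta>) * (\<integral>u. p u * K (x - u) \<partial>lborel) + integral\<^sup>L lborel (s x))
      \<longlongrightarrow> 0 + integral\<^sup>L lborel K) at_top"
    by (intro tendsto_add 1 2)
  moreover have "\<forall>\<^sub>F x in at_top. x powr (1 - \<beta>) * (\<integral>u. indicator {0..} u * u powr (\<beta> - 1) * K (x - u) \<partial>lborel)
      = x powr (1 - \<beta>) * (\<integral>u. p u * K (x - u) \<partial>lborel) + integral\<^sup>L lborel (s x)"
    using eventually_ge_at_top[of 1] by eventually_elim (use eq in auto)
  ultimately show "((\<lambda>x. x powr (1 - \<beta>) * (\<integral>u. indicator {0..} u * u powr (\<beta> - 1) * K (x - u) \<partial>lborel))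
        \<longlongrightarrow> integral\<^sup>L lborel K) at_top"
    by (simp add: tendsto_cong)
qed

text \<open>The surplus factor \<open>x powr - (\<alpha> - \<beta>)\<close> sends a convergent
  expression to \<open>0\<close>. This disposes of the terms with exponents
  \<open>\<alpha>s i\<close> and of the auxiliary power in the Tauberian majorant.\<close>

lemma tendsto_lower_powr_kernel:
  fixes K :: "real \<Rightarrow> real"
  assumes \<beta>: "0 < \<beta>" "\<beta> < \<alpha>" and K: "K \<in> borel_measurable borel"
    and decay: "\<And>v. \<bar>K v\<bar> \<le> C * (1 + \<bar>v\<bar>) powr - N" and N: "\<bar>\<beta> - 1\<bar> + 2 \<le> N"
  shows "((\<lambda>x. x powr (1 - \<alpha>) * (\<integral>u. indicator {0..} u * u powr (\<beta> - 1) * K (x - u) \<partial>lborel))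
        \<longlongrightarrow> 0) at_top"
proof -
  have "((\<lambda>x. x powr - (\<alpha> - \<beta>) * (x powr (1 - \<beta>) *
      (\<integral>u. indicator {0..} u * u powr (\<beta> - 1) * K (x - u) \<partial>lborel))) \<longlongrightarrow> 0 * integral\<^sup>L lborel K) at_top"
    using \<beta> by (intro tendsto_mult tendsto_powr_kernel[OF \<beta>(1) K decay N] tendsto_neg_powr filterlim_ident) auto
  then show ?thesis by (simp flip: mult.assoc powr_add)
qed

section \<open>Oscillatory integrals\<close>

text \<open>Half a period \<open>h = pi / x\<close> flips the sign of the exponential, so the integral over
  two consecutive half periods only sees the increment of \<open>\<phi>\<close> over \<open>h\<close>.\<close>

lemma oscillatory_integral_pairs:
  fixes \<phi> :: "real \<Rightarrow> complex"
  assumes cont: "continuous_on UNIV \<phi>" and x: "0 < x"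
  defines "h \<equiv> pi / x"
  shows "integral {a..a + 2 * real n * h} (\<lambda>t. exp (\<i> * of_real (x * t)) * \<phi> t) =
    integral {0..h} (\<lambda>t. exp (\<i> * of_real (x * (a + t))) *
      (\<Sum>k<n. \<phi> (a + t + real (2 * k) * h) - \<phi> (a + t + real (2 * k + 1) * h)))"
proof (induction n)
  case 0
  show ?case by simp
next
  case (Suc n)
  have h: "0 < h" using x by (simp add: h_def)
  define E where "E = (\<lambda>t. exp (\<i> * of_real (x * t)) * \<phi> t)"
  have contE: "continuous_on S E" for S
    unfolding E_def by (intro continuous_intros continuous_on_subset[OF cont]) auto
  have contphi: "continuous_on S (\<lambda>t. \<phi> (g t))" if "continuous_on S g" for g S
    by (rule continuous_on_compose2[OF cont that]) auto
  \<comment> \<open>\<open>c\<close> lies \<open>n\<close> full periods \<open>2 * h\<close> after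
    \<open>a\<close>, so the exponential at \<open>c + t\<close> equals that at \<open>a + t\<close>
    and the new pair of half periods shares the common factor.\<close>
  define c where "c = a + 2 * real n * h"
  have exp1: "exp (\<i> * of_real (x * (c + t))) = exp (\<i> * of_real (x * (a + t)))" for t
  proof -
    have "x * (c + t) = x * (a + t) + 2 * pi * real n"
      using x by (simp add: c_def h_def field_simps)
    then have "exp (\<i> * of_real (x * (c + t))) = exp (\<i> * of_real (x * (a + t))) * exp (2 * of_real pi * \<i>) ^ n"
      by (simp add: exp_add exp_of_nat_mult[symmetric] algebra_simps)
    then show ?thesis by simp
  qed
  have exp2: "exp (\<i> * of_real (x * (c + h + t))) = - exp (\<i> * of_real (x * (a + t)))" for t
  proof -
    have e: "x * (c + h + t) = x * (c + t) + pi"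
      using x by (simp add: h_def field_simps)
    have "exp (\<i> * of_real (x * (c + h + t))) = exp (\<i> * of_real (x * (c + t))) * exp (\<i> * of_real pi)"
      unfolding e of_real_add[of "x * (c + t)"] distrib_left[of \<i>] exp_add ..
    then show ?thesis by (simp only: exp1 exp_pi_i' mult_minus1_right)
  qed
  have ct: "c + t = a + t + real (2 * n) * h" "c + h + t = a + t + real (2 * n + 1) * h" for t
    by (simp_all add: c_def algebra_simps)
  have Ec: "E (c + t) = exp (\<i> * of_real (x * (a + t))) * \<phi> (a + t + real (2 * n) * h)" for t
    unfolding E_def exp1 unfolding ct(1) ..
  have Ech: "E (c + h + t) = - (exp (\<i> * of_real (x * (a + t))) * \<phi> (a + t + real (2 * n + 1) * h))" for t
    unfolding E_def exp2 unfolding ct(2) by simp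
  have "integral {a..a + 2 * real (Suc n) * h} E = integral {a..c} E + integral {c..c + 2 * h} E"
    using h by (subst Henstock_Kurzweil_Integration.integral_combine[where c = c])
      (auto simp: c_def algebra_simps intro!: integrable_continuous_interval contE)
  also have "integral {c..c + 2 * h} E = integral {c..c + h} E + integral {c + h..c + 2 * h} E"
    using h by (subst Henstock_Kurzweil_Integration.integral_combine[where c = "c + h"])
      (auto intro!: integrable_continuous_interval contE)
  also have "integral {c..c + h} E = integral {0..h} (\<lambda>t. E (c + t))"
    using integral_shift[of 0 c h E] contE by (simp add: o_def add.commute)
  also have "\<dots> = integral {0..h} (\<lambda>t. exp (\<i> * of_real (x * (a + t))) * \<phi> (a + t + real (2 * n) * h))"
    unfolding Ec ..
  also have "integral {c + h..c + 2 * h} E = integral {0..h} (\<lambda>t. E (c + h + t))"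
    using integral_shift[of 0 "c + h" h E] contE by (simp add: o_def add_ac)
  also have "\<dots> = integral {0..h} (\<lambda>t. - (exp (\<i> * of_real (x * (a + t))) * \<phi> (a + t + real (2 * n + 1) * h)))"
    unfolding Ech ..
  also have "integral {a..c} E = integral {0..h} (\<lambda>t. exp (\<i> * of_real (x * (a + t))) *
      (\<Sum>k<n. \<phi> (a + t + real (2 * k) * h) - \<phi> (a + t + real (2 * k + 1) * h)))"
    using Suc by (simp add: E_def c_def)
  also have "\<dots> + (integral {0..h} (\<lambda>t. exp (\<i> * of_real (x * (a + t))) * \<phi> (a + t + real (2 * n) * h)) +
      integral {0..h} (\<lambda>t. - (exp (\<i> * of_real (x * (a + t))) * \<phi> (a + t + real (2 * n + 1) * h)))) =
     integral {0..h} (\<lambda>t. exp (\<i> * of_real (x * (a + t))) *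
      (\<Sum>k<Suc n. \<phi> (a + t + real (2 * k) * h) - \<phi> (a + t + real (2 * k + 1) * h)))"
    by (subst Henstock_Kurzweil_Integration.integral_add[symmetric],
        (intro integrable_continuous_interval continuous_intros contphi)+)+
      (simp add: algebra_simps)
  finally show ?case by (simp add: E_def)
qed

text \<open>Full periods contribute at most \<open>D\<close> over a half period, by pairing; the
  leftover, shorter than a period, is bounded trivially through \<open>M\<close>. Uniform continuity
  and bounded variation are two ways of supplying \<open>D\<close>.\<close>

lemma oscillatory_integral_bound:
  fixes \<phi> :: "real \<Rightarrow> complex"
  assumes cont: "continuous_on UNIV \<phi>" and x: "0 < x" and ab: "a \<le> b"
    and M: "\<And>t. t \<in> {a..b} \<Longrightarrow> norm (\<phi> t) \<le> M"
    and D: "\<And>t n. t \<in> {0..pi / x} \<Longrightarrow> a + 2 * real n * (pi / x) \<le> b \<Longrightarrow>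
      (\<Sum>k<n. norm (\<phi> (a + t + real (2 * k) * (pi / x)) - \<phi> (a + t + real (2 * k + 1) * (pi / x)))) \<le> D"
  shows "norm (integral {a..b} (\<lambda>t. exp (\<i> * of_real (x * t)) * \<phi> t)) \<le> (D + 2 * M) * (pi / x)"
proof -
  define h where "h = pi / x"
  have h: "0 < h" using x by (simp add: h_def)
  define E where "E = (\<lambda>t. exp (\<i> * of_real (x * t)) * \<phi> t)"
  have contE: "continuous_on S E" for S
    unfolding E_def by (intro continuous_intros continuous_on_subset[OF cont]) auto
  have contphi: "continuous_on S (\<lambda>t. \<phi> (g t))" if "continuous_on S g" for g S
    by (rule continuous_on_compose2[OF cont that]) auto
  \<comment> \<open>The number of full periods \<open>2 * h\<close> that fit into
    \<open>{a..b}\<close>.\<close>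
  define n where "n = nat \<lfloor>(b - a) / (2 * h)\<rfloor>"
  define c where "c = a + 2 * real n * h"
  have "real n \<le> (b - a) / (2 * h)" "(b - a) / (2 * h) < real n + 1"
    using ab h by (auto simp: n_def)
  then have c: "a \<le> c" "c \<le> b" "b - c \<le> 2 * h" using h by (auto simp: c_def field_simps)
  have "norm (integral {a..c} E) \<le> D * (h - 0)"
    unfolding E_def c_def h_def oscillatory_integral_pairs[OF cont x]
  proof (rule integral_bound)
    fix t assume t: "t \<in> {0..pi / x}"
    have "norm (\<Sum>k<n. \<phi> (a + t + real (2 * k) * (pi / x)) - \<phi> (a + t + real (2 * k + 1) * (pi / x))) \<le> D"
      by (rule order_trans[OF norm_sum D[OF t]]) (use c in \<open>simp add: c_def h_def\<close>)
    then show "norm (exp (\<i> * of_real (x * (a + t))) * (\<Sum>k<n. \<phi> (a + t + real (2 * k) * (pi / x)) - \<phi> (a + t + real (2 * k + 1) * (pi / x)))) \<le> D"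
      by (simp add: norm_mult)
  qed (use x in \<open>auto intro!: continuous_intros contphi\<close>)
  moreover have "norm (integral {c..b} E) \<le> M * (b - c)"
    by (rule integral_bound) (use c M contE in \<open>auto simp: E_def norm_mult\<close>)
  moreover have "M * (b - c) \<le> M * (2 * h)"
    using c M[of a] ab by (intro mult_left_mono) (auto intro: order_trans[OF norm_ge_zero])
  moreover have "integral {a..b} E = integral {a..c} E + integral {c..b} E"
    using c by (intro Henstock_Kurzweil_Integration.integral_combine[symmetric])
      (auto intro!: integrable_continuous_interval contE)
  ultimately have "norm (integral {a..b} E) \<le> D * h + M * (2 * h)"
    using norm_triangle_ineq[of "integral {a..c} E" "integral {c..b} E"] by simp
  then show ?thesis by (simp add: E_def h_def algebra_simps)
qed

lemma continuous_norm_bound: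
  fixes \<phi> :: "real \<Rightarrow> complex"
  assumes "continuous_on UNIV \<phi>"
  obtains M where "0 \<le> M" "\<And>t. t \<in> {-L..L} \<Longrightarrow> norm (\<phi> t) \<le> M"
proof -
  have "compact (\<phi> ` {-L..L})"
    by (intro compact_continuous_image continuous_on_subset[OF assms]) auto
  then have "bounded (\<phi> ` {-L..L})" by (rule compact_imp_bounded)
  then obtain M where "\<forall>y\<in>\<phi> ` {-L..L}. norm y \<le> M" by (auto simp: bounded_iff)
  then show thesis by (intro that[of "max 0 M"]) (auto simp: le_max_iff_disj)
qed

text \<open>At most \<open>(b - a) / (2 * h)\<close> pairs occur, and uniform continuity makes each
  increment smaller than \<open>\<eta>\<close> once \<open>h = pi / x\<close> is small, so the
  factor \<open>h\<close> cancels. The threshold must not depend on \<open>a\<close> and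
  \<open>b\<close>, because the bound is applied to a window whose position varies.\<close>

lemma riemann_lebesgue_uniform:
  fixes \<phi> :: "real \<Rightarrow> complex"
  assumes cont: "continuous_on UNIV \<phi>" and "0 < e"
  shows "\<exists>X>0. \<forall>x\<ge>X. \<forall>a b. - L \<le> a \<longrightarrow> a \<le> b \<longrightarrow> b \<le> L \<longrightarrow>
    norm (integral {a..b} (\<lambda>t. exp (\<i> * of_real (x * t)) * \<phi> t)) \<le> e"
proof -
  obtain M where M: "0 \<le> M" "\<And>t. t \<in> {-L..L} \<Longrightarrow> norm (\<phi> t) \<le> M"
    using continuous_norm_bound[OF cont] by blast
  \<comment> \<open>Half of \<open>e\<close> pays for the pairs, whose total is at most
    \<open>\<eta> * (2 * |L| + 1)\<close>. The summand \<open>1\<close> keeps the denominator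
    positive.\<close>
  define \<eta> where "\<eta> = e / (2 * (2 * \<bar>L\<bar> + 1))"
  have \<eta>: "0 < \<eta>" using \<open>0 < e\<close> by (simp add: \<eta>_def add_nonneg_pos)
  have "uniformly_continuous_on {-L..L + 1} \<phi>"
    by (intro compact_uniformly_continuous continuous_on_subset[OF cont]) auto
  from this[unfolded uniformly_continuous_on_def, rule_format, OF \<eta>] obtain d where d: "0 < d"
    and ucont: "\<And>s t. s \<in> {-L..L + 1} \<Longrightarrow> t \<in> {-L..L + 1} \<Longrightarrow> dist t s < d \<Longrightarrow> dist (\<phi> t) (\<phi> s) < \<eta>"
    by blast
  \<comment> \<open>The three entries give in turn \<open>h \<le> 1\<close>,
    \<open>h \<le> d / 2\<close> and \<open>2 * M * h \<le> e / 2\<close>, the last paying for the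
    leftover piece.\<close>
  define X where "X = Max {pi, pi / (d / 2), 4 * M * pi / e}"
  have X: "pi \<le> X" "pi / (d / 2) \<le> X" "4 * M * pi / e \<le> X" by (auto simp: X_def)
  show ?thesis
  proof (intro exI[of _ X] conjI allI impI)
    show "0 < X" using X(1) pi_gt_zero by linarith
    fix x a b :: real
    assume x: "X \<le> x" and ab: "- L \<le> a" "a \<le> b" "b \<le> L"
    have x0: "0 < x" using X(1) x pi_gt_zero by linarith
    define h where "h = pi / x"
    have h: "0 < h" "h \<le> 1" "h \<le> d / 2" "2 * M * h \<le> e / 2"
    proof -
      show "0 < h" using x0 by (simp add: h_def)
      show "h \<le> 1" using x0 X(1) x by (simp add: h_def)
      have "pi / (d / 2) \<le> x" "4 * M * pi / e \<le> x" using X x by auto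
      then show "h \<le> d / 2" "2 * M * h \<le> e / 2" using x0 d \<open>0 < e\<close> by (auto simp: h_def field_simps)
    qed
    have "norm (integral {a..b} (\<lambda>t. exp (\<i> * of_real (x * t)) * \<phi> t)) \<le> (\<eta> * ((b - a) / (2 * h)) + 2 * M) * (pi / x)"
    proof (rule oscillatory_integral_bound[OF cont x0 ab(2)])
      show "norm (\<phi> t) \<le> M" if "t \<in> {a..b}" for t using that ab by (intro M) auto
      fix t :: real and n :: nat
      assume t: "t \<in> {0..pi / x}" and n: "a + 2 * real n * (pi / x) \<le> b"
      have "(\<Sum>k<n. norm (\<phi> (a + t + real (2 * k) * h) - \<phi> (a + t + real (2 * k + 1) * h))) \<le> (\<Sum>k<n. \<eta>)"
      proof (rule sum_mono)
        fix k assume "k \<in> {..<n}"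
        then have "real (2 * k + 2) * h \<le> 2 * real n * h" using h by (intro mult_right_mono) auto
        then have k: "a + real (2 * k) * h + 2 * h \<le> b" using n by (simp add: h_def algebra_simps)
        define r where "r = real (2 * k) * h"
        have r: "0 \<le> r" "real (2 * k + 1) * h = r + h" "real (2 * k) * h = r"
          using h by (simp_all add: r_def algebra_simps)
        have t': "0 \<le> t" "t \<le> h" using t by (auto simp: h_def)
        have "dist (\<phi> (a + t + real (2 * k) * h)) (\<phi> (a + t + real (2 * k + 1) * h)) < \<eta>"
        proof (rule ucont)
          show "a + t + real (2 * k + 1) * h \<in> {- L..L + 1}" "a + t + real (2 * k) * h \<in> {- L..L + 1}"
            using t' k ab h r(1) unfolding r(2,3) atLeastAtMost_iff by linarith+
          show "dist (a + t + real (2 * k) * h) (a + t + real (2 * k + 1) * h) < d"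
            using h d by (simp add: dist_real_def algebra_simps)
        qed
        then show "norm (\<phi> (a + t + real (2 * k) * h) - \<phi> (a + t + real (2 * k + 1) * h)) \<le> \<eta>"
          by (simp add: dist_norm)
      qed
      also have "\<dots> = \<eta> * real n" by simp
      also have "\<dots> \<le> \<eta> * ((b - a) / (2 * h))"
        using n h \<eta> by (intro mult_left_mono) (auto simp: h_def[symmetric] field_simps)
      finally show "(\<Sum>k<n. norm (\<phi> (a + t + real (2 * k) * (pi / x)) - \<phi> (a + t + real (2 * k + 1) * (pi / x)))) \<le> \<eta> * ((b - a) / (2 * h))"
        by (simp add: h_def)
    qed
    also have "\<dots> = \<eta> * ((b - a) / 2) + 2 * M * h" using h by (simp add: h_def[symmetric] field_simps)
    also have "\<eta> * ((b - a) / 2) \<le> \<eta> * (2 * \<bar>L\<bar> + 1)" using \<eta> ab by (intro mult_left_mono) auto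
    also have "\<eta> * (2 * \<bar>L\<bar> + 1) = e / 2"
      by (simp add: \<eta>_def) (simp add: field_simps)
    finally show "norm (integral {a..b} (\<lambda>t. exp (\<i> * of_real (x * t)) * \<phi> t)) \<le> e" using h by simp
  qed
qed

section \<open>Bounded variation and the rate \<open>1 / x\<close>\<close>

text \<open>Restates finite variation for arbitrary finite chains. A chain strictly inside the
  interval becomes a partition once both endpoints are attached, and the two extra terms are
  nonnegative.\<close>

lemma bounded_variation_bound:
  assumes "bounded_variation a b g"
  obtains V where "\<And>n y. \<forall>i<n. y i < y (Suc i) \<Longrightarrow> a < y 0 \<Longrightarrow> y n < b \<Longrightarrow>
    (\<Sum>i<n. \<bar>g (y (Suc i)) - g (y i)\<bar>) \<le> V"
proof -
  define V where "V = enn2real (total_variation a b g)"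
  have V: "total_variation a b g = ennreal V"
    using assms by (simp add: V_def bounded_variation_def)
  show thesis
  proof (rule that[of V])
    fix n :: nat and y :: "nat \<Rightarrow> real"
    assume y: "\<forall>i<n. y i < y (Suc i)" "a < y 0" "y n < b"
    \<comment> \<open>The chain \<open>y 0, ..., y n\<close> is moved to the indices
      \<open>1, ..., n + 1\<close>, with \<open>a\<close> at index \<open>0\<close> and
      \<open>b\<close> at \<open>n + 2\<close>.\<close>
    define z where "z i = (if i = 0 then a else if i = n + 2 then b else y (i - 1))" for i
    have "(n + 2, z) \<in> partitions a b"
      unfolding partitions_def
    proof (clarsimp, intro conjI ballI)
      fix i assume i: "i \<in> {Suc 0..Suc (Suc n)}"
      show "z (i - Suc 0) < z i"
      proof (cases "i = 1 \<or> i = n + 2")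
        case True
        then show ?thesis using y by (cases "i = 1") (simp_all add: z_def)
      next
        case False
        then obtain j where "i = Suc (Suc j)" "j < n"
          using i by (cases i; cases "i - 1") auto
        then show ?thesis using y(1) by (simp add: z_def)
      qed
    qed (auto simp: z_def)
    then have "ennreal (\<Sum>i=1..n+2. \<bar>g (z i) - g (z (i - 1))\<bar>) \<le> total_variation a b g"
      unfolding total_variation_def by (intro SUP_upper2) auto
    then have "(\<Sum>i=1..n+2. \<bar>g (z i) - g (z (i - 1))\<bar>) \<le> V"
      unfolding V by (subst (asm) ennreal_le_iff) (simp_all add: V_def)
    moreover have ends: "sum F {..<Suc (Suc n)} = F 0 + (\<Sum>i<n. F (Suc i)) + F (Suc n)" for F :: "nat \<Rightarrow> real"
      by (subst sum.lessThan_Suc_shift) simp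
    moreover have "(\<Sum>i=1..n+2. \<bar>g (z i) - g (z (i - 1))\<bar>) = \<bar>g (z 1) - g (z 0)\<bar> +
        (\<Sum>i<n. \<bar>g (z (i + 2)) - g (z (i + 1))\<bar>) + \<bar>g (z (n + 2)) - g (z (n + 1))\<bar>"
      using ends[of "\<lambda>i. \<bar>g (z (Suc i)) - g (z i)\<bar>"]
      unfolding One_nat_def sum.atLeast1_atMost_eq by simp
    moreover have "(\<Sum>i<n. \<bar>g (z (i + 2)) - g (z (i + 1))\<bar>) = (\<Sum>i<n. \<bar>g (y (Suc i)) - g (y i)\<bar>)"
      by (intro sum.cong) (simp_all add: z_def)
    ultimately show "(\<Sum>i<n. \<bar>g (y (Suc i)) - g (y i)\<bar>) \<le> V" by linarith
  qed
qed

lemma sum_even_le: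
  fixes g :: "nat \<Rightarrow> real"
  assumes "\<And>i. 0 \<le> g i"
  shows "(\<Sum>k<n. g (2 * k)) \<le> (\<Sum>i<2 * n. g i)"
proof (induction n)
  case (Suc n)
  then show ?case using assms[of "2 * n + 1"] by simp
qed simp

text \<open>The paired increments are every second increment of a chain with step \<open>h\<close>.
  Their sum is therefore bounded by the variations of real and imaginary part, independently of
  \<open>x\<close>, and only the factor \<open>pi / x\<close> remains.\<close>

lemma riemann_lebesgue_bounded_variation:
  fixes \<phi> :: "real \<Rightarrow> complex"
  assumes cont: "continuous_on UNIV \<phi>" and bv: "locally_bounded_variation \<phi>" and L: "0 \<le> L"
  shows "\<exists>B. \<forall>x\<ge>pi. \<forall>a b. - L \<le> a \<longrightarrow> a \<le> b \<longrightarrow> b \<le> L \<longrightarrow>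
    norm (integral {a..b} (\<lambda>t. exp (\<i> * of_real (x * t)) * \<phi> t)) \<le> B / x"
proof -
  obtain M where M: "0 \<le> M" "\<And>t. t \<in> {-L..L} \<Longrightarrow> norm (\<phi> t) \<le> M"
    using continuous_norm_bound[OF cont] by blast
  \<comment> \<open>The interval exceeds \<open>{-L..L}\<close> because chains must lie strictly
    inside it and a chain may pass \<open>b\<close> by up to \<open>h \<le> 1\<close>.\<close>
  have bv: "bounded_variation (- (L + 1)) (L + 3) (\<lambda>t. Re (\<phi> t))"
    "bounded_variation (- (L + 1)) (L + 3) (\<lambda>t. Im (\<phi> t))"
    using bv L by (auto simp: locally_bounded_variation_def complex_bounded_variation_def)
  obtain V1 where
    V1: "\<And>n y. \<forall>i<n. y i < y (Suc i) \<Longrightarrow> - (L + 1) < y 0 \<Longrightarrow> y n < L + 3 \<Longrightarrow>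
      (\<Sum>i<n. \<bar>Re (\<phi> (y (Suc i))) - Re (\<phi> (y i))\<bar>) \<le> V1"
    using bounded_variation_bound[OF bv(1)] by blast
  obtain V2 where
    V2: "\<And>n y. \<forall>i<n. y i < y (Suc i) \<Longrightarrow> - (L + 1) < y 0 \<Longrightarrow> y n < L + 3 \<Longrightarrow>
      (\<Sum>i<n. \<bar>Im (\<phi> (y (Suc i))) - Im (\<phi> (y i))\<bar>) \<le> V2"
    using bounded_variation_bound[OF bv(2)] by blast
  show ?thesis
  proof (intro exI[of _ "(V1 + V2 + 2 * M) * pi"] allI impI)
    fix x a b :: real
    assume x: "pi \<le> x" and ab: "- L \<le> a" "a \<le> b" "b \<le> L"
    have x0: "0 < x" using x pi_gt_zero by linarith
    define h where "h = pi / x"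
    have h: "0 < h" "h \<le> 1" using x x0 by (auto simp: h_def)
    have "norm (integral {a..b} (\<lambda>t. exp (\<i> * of_real (x * t)) * \<phi> t)) \<le> (V1 + V2 + 2 * M) * (pi / x)"
    proof (rule oscillatory_integral_bound[OF cont x0 ab(2)])
      show "norm (\<phi> t) \<le> M" if "t \<in> {a..b}" for t using that ab by (intro M) auto
      fix t :: real and n :: nat
      assume t: "t \<in> {0..pi / x}" and n: "a + 2 * real n * (pi / x) \<le> b"
      define y where "y i = a + t + real i * h" for i
      have y: "\<forall>i<2 * n. y i < y (Suc i)" "- (L + 1) < y 0" "y (2 * n) < L + 3"
        using h t n ab by (auto simp: y_def h_def[symmetric] algebra_simps)
      have "(\<Sum>k<n. norm (\<phi> (a + t + real (2 * k) * h) - \<phi> (a + t + real (2 * k + 1) * h)))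
          = (\<Sum>k<n. norm (\<phi> (y (Suc (2 * k))) - \<phi> (y (2 * k))))"
        by (simp add: y_def norm_minus_commute)
      also have "\<dots> \<le> (\<Sum>i<2 * n. norm (\<phi> (y (Suc i)) - \<phi> (y i)))"
        by (rule sum_even_le) simp
      also have "\<dots> \<le> (\<Sum>i<2 * n. \<bar>Re (\<phi> (y (Suc i))) - Re (\<phi> (y i))\<bar> + \<bar>Im (\<phi> (y (Suc i))) - Im (\<phi> (y i))\<bar>)"
        using cmod_le[of "\<phi> (y (Suc i)) - \<phi> (y i)" for i] by (intro sum_mono) simp
      also have "\<dots> \<le> V1 + V2"
        unfolding sum.distrib using V1[OF y] V2[OF y] by (rule add_mono)
      finally show "(\<Sum>k<n. norm (\<phi> (a + t + real (2 * k) * (pi / x)) - \<phi> (a + t + real (2 * k + 1) * (pi / x)))) \<le> V1 + V2"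
        by (simp add: h_def)
    qed
    then show "norm (integral {a..b} (\<lambda>t. exp (\<i> * of_real (x * t)) * \<phi> t)) \<le> (V1 + V2 + 2 * M) * pi / x" by simp
  qed
qed

section \<open>Sinc kernels\<close>

lemma integral_convolution:
  fixes f :: "real \<Rightarrow> complex"
  assumes M: "prob_space M" "sets M = sets borel" and N: "prob_space N" "sets N = sets borel"
    and f[measurable]: "f \<in> borel_measurable borel" and bound: "\<And>t. norm (f t) \<le> B"
  shows "integral\<^sup>L (M \<star> N) f = (\<integral>s. \<integral>t. f (s + t) \<partial>N \<partial>M)"
proof -
  interpret M: prob_space M by fact
  interpret N: prob_space N by fact
  interpret pair_prob_space M N ..
  note M(2)[measurable_cong] N(2)[measurable_cong]
  have "integral\<^sup>L (M \<star> N) f = (\<integral>z. f (fst z + snd z) \<partial>(M \<Otimes>\<^sub>M N))"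
    unfolding convolution_def by (subst integral_distr) (auto simp: case_prod_beta)
  also have "\<dots> = (\<integral>s. \<integral>t. f (s + t) \<partial>N \<partial>M)"
    by (subst integral_fst'[symmetric]) (auto intro!: P.integrable_const_bound[where B = B] bound)
  finally show ?thesis .
qed

text \<open>The law of a sum of \<open>n\<close> independent variables uniform on \<open>[-l, l]\<close>: compactly supported,
  with characteristic function \<open>sinc (l y) ^ n\<close>.\<close>

primrec unif_sum :: "real \<Rightarrow> nat \<Rightarrow> real measure" where
  "unif_sum l 0 = return borel 0"
| "unif_sum l (Suc n) = (unif_sum l n \<star> uniform_measure lborel {-l..l})"

lemma prob_space_uniform_interval:
  assumes "0 < (l :: real)" shows "prob_space (uniform_measure lborel {-l..l})"
  by (rule prob_space_uniform_measure) (use assms in \<open>auto simp: emeasure_lborel_Icc_eq\<close>)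

lemma sets_unif_sum [simp, measurable_cong]: "sets (unif_sum l n) = sets borel"
  by (cases n) auto

lemma prob_space_unif_sum:
  assumes "0 < l" shows "prob_space (unif_sum l n)"
proof (induction n)
  case 0
  show ?case by (simp add: prob_space_return)
next
  case (Suc n)
  interpret M: prob_space "unif_sum l n" by fact
  interpret N: prob_space "uniform_measure lborel {-l..l}" using assms by (rule prob_space_uniform_interval)
  interpret pair_prob_space "unif_sum l n" "uniform_measure lborel {-l..l}" ..
  show ?case
    unfolding unif_sum.simps convolution_def by (rule P.prob_space_distr) measurable
qed

lemma AE_unif_sum:
  assumes "0 < l" shows "AE t in unif_sum l n. \<bar>t\<bar> \<le> real n * l"
proof (induction n)
  case 0
  show ?case unfolding unif_sum.simps by (subst AE_return) auto
next
  case (Suc n)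
  interpret M: prob_space "unif_sum l n" using assms by (rule prob_space_unif_sum)
  interpret N: prob_space "uniform_measure lborel {-l..l}" using assms by (rule prob_space_uniform_interval)
  interpret pair_prob_space "unif_sum l n" "uniform_measure lborel {-l..l}" ..
  have N: "AE t in uniform_measure lborel {-l..l}. \<bar>t\<bar> \<le> l"
    by (rule AE_uniform_measureI) auto
  have "AE z in unif_sum l n \<Otimes>\<^sub>M uniform_measure lborel {-l..l}. \<bar>fst z + snd z\<bar> \<le> real (Suc n) * l"
  proof (rule AE_pair_measure)
    show "AE s in unif_sum l n. AE t in uniform_measure lborel {-l..l}. \<bar>fst (s, t) + snd (s, t)\<bar> \<le> real (Suc n) * l"
      using Suc
    proof eventually_elim
      case (elim s)
      from N show ?case by eventually_elim (use elim in \<open>auto simp: distrib_right\<close>)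
    qed
  qed measurable
  then show ?case
    unfolding unif_sum.simps convolution_def by (subst AE_distr_iff) (auto simp: case_prod_beta)
qed

text \<open>Connects expectations with the Henstock-Kurzweil integrals in which the oscillatory
  estimates are phrased.\<close>

lemma integral_uniform_interval:
  fixes f :: "real \<Rightarrow> complex"
  assumes "0 < l" "continuous_on UNIV f"
  shows "integral\<^sup>L (uniform_measure lborel {-l..l}) f = integral {-l..l} f /\<^sub>R (2 * l)"
proof -
  have [measurable]: "f \<in> borel_measurable borel"
    using assms(2) by (rule borel_measurable_continuous_onI)
  have eq: "uniform_measure lborel {-l..l} = density lborel (\<lambda>t. ennreal (indicator {-l..l} t / (2 * l)))"
  proof -
    have "indicator {-l..l} t / emeasure lborel {-l..l} = ennreal (indicator {-l..l} t / (2 * l))" for t :: real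
    proof -
      have "emeasure lborel {-l..l} = ennreal (2 * l)" using assms(1) by (simp add: emeasure_lborel_Icc_eq)
      then show ?thesis
        unfolding ennreal_indicator[symmetric] using assms(1) by (simp add: divide_ennreal)
    qed
    then show ?thesis unfolding uniform_measure_def by simp
  qed
  have "integral\<^sup>L (uniform_measure lborel {-l..l}) f = (\<integral>t. (indicator {-l..l} t / (2 * l)) *\<^sub>R f t \<partial>lborel)"
    unfolding eq by (rule integral_density) (use assms(1) in auto)
  also have "\<dots> = (\<integral>t. (indicator {-l..l} t *\<^sub>R f t) /\<^sub>R (2 * l) \<partial>lborel)"
    by (simp only: scaleR_scaleR divide_inverse mult.commute)
  also have "\<dots> = (LINT t:{-l..l}|lborel. f t) /\<^sub>R (2 * l)"
    unfolding set_lebesgue_integral_def by (rule integral_scaleR_right)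
  also have "(LINT t:{-l..l}|lborel. f t) = integral {-l..l} f"
    by (intro set_borel_integral_eq_integral borel_integrable_atLeastAtMost' continuous_on_subset[OF assms(2)]) auto
  finally show ?thesis .
qed

lemma char_uniform_interval:
  assumes "0 < l" shows "char (uniform_measure lborel {-l..l}) y = of_real (sinc (l * y))"
proof (cases "y = 0")
  case True
  then show ?thesis
    using assms unfolding char_def by (simp add: integral_uniform_interval scaleR_conv_of_real)
next
  case False
  define c where "c = \<i> * complex_of_real y"
  have c: "c \<noteq> 0" using False by (simp add: c_def)
  have "((\<lambda>z. exp (c * z) / c) has_field_derivative exp (c * z)) (at z)" for z
    using c by (auto intro!: derivative_eq_intros)
  then have "((\<lambda>t. exp (c * of_real t)) has_integral
      (exp (c * of_real l) / c - exp (c * of_real (- l)) / c)) {-l..l}"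
    using assms by (intro fundamental_theorem_of_calculus has_vector_derivative_real_field) auto
  then have "integral {-l..l} (\<lambda>t. exp (\<i> * of_real (y * t))) =
      (exp (\<i> * of_real (y * l)) - exp (\<i> * of_real (- (y * l)))) / (\<i> * of_real y)"
    by (simp add: integral_unique diff_divide_distrib c_def mult.assoc)
  also have "exp (\<i> * of_real (y * l)) - exp (\<i> * of_real (- (y * l))) = 2 * \<i> * sin (y * l)"
    unfolding cis_conv_exp[symmetric] by (simp add: complex_eq_iff)
  also have "2 * \<i> * sin (y * l) / (\<i> * of_real y) = 2 * sin (y * l) / y"
    using False by (simp add: field_simps)
  finally have "integral {-l..l} (\<lambda>t. exp (\<i> * of_real (y * t))) = 2 * sin (y * l) / y" .
  moreover have "char (uniform_measure lborel {-l..l}) y =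
      integral {-l..l} (\<lambda>t. exp (\<i> * of_real (y * t))) /\<^sub>R (2 * l)"
    unfolding char_def by (rule integral_uniform_interval[OF assms]) (intro continuous_intros)
  ultimately have "char (uniform_measure lborel {-l..l}) y =
      complex_of_real (2 * sin (y * l) / y) /\<^sub>R (2 * l)"
    by (simp only: of_real_divide of_real_mult of_real_numeral)
  also have "\<dots> = of_real (sinc (l * y))"
    using assms False by (simp add: scaleR_conv_of_real field_simps)
  finally show ?thesis .
qed

lemma char_unif_sum:
  assumes "0 < l" shows "char (unif_sum l n) y = of_real (sinc (l * y) ^ n)"
proof (induction n)
  case 0
  show ?case by (simp add: char_def integral_return)
next
  case (Suc n)
  let ?U = "uniform_measure lborel {-l..l}"
  have "char (unif_sum l (Suc n)) y = (\<integral>s. \<integral>t. iexp (y * (s + t)) \<partial>?U \<partial>unif_sum l n)"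
    unfolding char_def unif_sum.simps
    by (rule integral_convolution[where B = 1])
      (use assms in \<open>auto intro: prob_space_unif_sum prob_space_uniform_interval\<close>)
  also have "\<dots> = (\<integral>s. \<integral>t. iexp (y * s) * iexp (y * t) \<partial>?U \<partial>unif_sum l n)"
    by (simp add: distrib_left exp_add)
  also have "\<dots> = char (unif_sum l n) y * char ?U y" by (simp add: char_def)
  finally show ?case using Suc char_uniform_interval[OF assms] by simp
qed

lemma abs_sinc_le_one: "\<bar>sinc y\<bar> \<le> 1"
proof (cases "y = 0")
  case False
  then show ?thesis using abs_sin_x_le_abs_x[of y] by (simp add: divide_le_eq_1)
qed simp

lemma abs_sinc_le: "\<bar>sinc y\<bar> \<le> 2 / (1 + \<bar>y\<bar>)"
proof (cases "y = 0")
  case False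
  have "\<bar>sinc y\<bar> * \<bar>y\<bar> \<le> 1" using False by (simp add: abs_divide)
  with abs_sinc_le_one[of y] have "\<bar>sinc y\<bar> * (1 + \<bar>y\<bar>) \<le> 2" by (simp add: distrib_left)
  then show ?thesis by (simp add: pos_le_divide_eq add_pos_nonneg)
qed simp

text \<open>For \<open>1 \<le> l\<close> compressing the kernel only improves its decay, so the
  constant is independent of \<open>l\<close>; any prescribed decay rate is reached by raising
  \<open>n\<close>.\<close>

lemma sinc_power_decay:
  assumes "1 \<le> l" shows "\<bar>sinc (l * y) ^ n\<bar> \<le> 2 ^ n * (1 + \<bar>y\<bar>) powr - real n"
proof -
  have "\<bar>y\<bar> \<le> \<bar>l * y\<bar>" using assms by (simp add: abs_mult mult_le_cancel_right1)
  then have "\<bar>sinc (l * y)\<bar> \<le> 2 / (1 + \<bar>y\<bar>)"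
    by (intro order_trans[OF abs_sinc_le] divide_left_mono) (auto intro: mult_pos_pos)
  then have "\<bar>sinc (l * y)\<bar> ^ n \<le> (2 / (1 + \<bar>y\<bar>)) ^ n" by (intro power_mono) auto
  also have "\<dots> = 2 ^ n * (1 + \<bar>y\<bar>) powr - real n"
    by (simp add: power_divide powr_minus powr_realpow add_pos_nonneg divide_inverse power_inverse)
  finally show ?thesis by (simp add: power_abs)
qed

text \<open>Parseval's formula by Fubini: smoothing \<open>v\<close> with the characteristic
  function of \<open>M\<close> averages the Fourier transform of \<open>v\<close> over
  \<open>M\<close>. It is this step that brings in the values of \<open>G\<close> on vertical
  lines.\<close>

lemma integral_iexp_char:
  fixes v :: "real \<Rightarrow> complex"
  assumes M: "prob_space M" "sets M = sets borel" and v: "integrable lborel v"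
  shows "(\<integral>u. v u * char M (x - u) \<partial>lborel) =
    (\<integral>t. iexp (x * t) * (\<integral>u. v u * iexp (- (t * u)) \<partial>lborel) \<partial>M)"
proof -
  interpret M: prob_space M by fact
  interpret pair_sigma_finite lborel M ..
  note M(2)[measurable_cong]
  have [measurable]: "v \<in> borel_measurable borel" using v by auto
  have int: "integrable (lborel \<Otimes>\<^sub>M M) (\<lambda>(u, t). v u * iexp ((x - u) * t))"
  proof (rule Fubini_integrable)
    show "integrable lborel (\<lambda>u. \<integral>t. norm (case (u, t) of (u, t) \<Rightarrow> v u * iexp ((x - u) * t)) \<partial>M)"
      using v by (simp add: norm_mult)
    show "AE u in lborel. integrable M (\<lambda>t. case (u, t) of (u, t) \<Rightarrow> v u * iexp ((x - u) * t))"
    proof (rule AE_I2)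
      fix u
      show "integrable M (\<lambda>t. case (u, t) of (u, t) \<Rightarrow> v u * iexp ((x - u) * t))"
        by (rule M.integrable_const_bound[where B = "norm (v u)"]) (auto simp: norm_mult)
    qed
  qed measurable
  have "(\<integral>u. v u * char M (x - u) \<partial>lborel) = (\<integral>u. \<integral>t. v u * iexp ((x - u) * t) \<partial>M \<partial>lborel)"
    unfolding char_def by simp
  also have "\<dots> = (\<integral>t. \<integral>u. v u * iexp ((x - u) * t) \<partial>lborel \<partial>M)"
    using Fubini_integral[OF int] by simp
  also have "\<dots> = (\<integral>t. \<integral>u. iexp (x * t) * (v u * iexp (- (t * u))) \<partial>lborel \<partial>M)"
    by (intro Bochner_Integration.integral_cong refl) (simp add: algebra_simps flip: exp_add)
  finally show ?thesis by simp
qed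

section \<open>From averages to pointwise asymptotics\<close>

text \<open>Holds because \<open>(x / (x + c)) powr p\<close> tends to \<open>1\<close>. It allows
  kernels centred at \<open>x + t\<close> or \<open>x - t\<close> instead of
  \<open>x\<close>.\<close>

lemma tendsto_powr_shift:
  fixes I :: "real \<Rightarrow> real"
  assumes "((\<lambda>x. x powr p * I x) \<longlongrightarrow> B) at_top"
  shows "((\<lambda>x. x powr p * I (x + c)) \<longlongrightarrow> B) at_top"
proof -
  have shift: "filterlim (\<lambda>x::real. x + c) at_top at_top"
    by (rule filterlim_at_top_mono[OF filterlim_tendsto_add_at_top[OF tendsto_const[of c] filterlim_ident]])
      (simp add: add.commute)
  have "((\<lambda>x. (1 - c / (x + c)) powr p * ((x + c) powr p * I (x + c))) \<longlongrightarrow> (1 - 0) powr p * B) at_top"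
    by (intro tendsto_intros real_tendsto_divide_at_top shift filterlim_compose[OF assms shift]) auto
  moreover have "\<forall>\<^sub>F x in at_top. (1 - c / (x + c)) powr p * ((x + c) powr p * I (x + c)) = x powr p * I (x + c)"
    using eventually_gt_at_top[of "\<bar>c\<bar>"]
  proof eventually_elim
    case (elim x)
    have "1 - c / (x + c) = x / (x + c)" using elim by (simp add: field_simps)
    then show ?case using elim by (simp add: powr_divide)
  qed
  ultimately show ?thesis by (simp add: tendsto_cong)
qed

text \<open>The kernel is centred at \<open>x + t\<close>: monotonicity of \<open>f\<close> bounds \<open>w\<close> from below by
  \<open>w x * exp (- 2 t)\<close> on the whole window \<open>[x, x + 2 t]\<close>.\<close>

lemma tauberian_kernel_upper:
  fixes f K :: "real \<Rightarrow> real"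
  defines "w \<equiv> \<lambda>u. indicator {0..} u * (f u * exp (- u))"
  assumes f: "mono f" "\<And>u. 0 \<le> f u" and t: "0 < t"
    and K: "K \<in> borel_measurable borel" "\<And>v. 0 \<le> K v" "integrable lborel K"
    and int: "integrable lborel (\<lambda>u. w u * K (x + t - u))" and x: "0 \<le> x"
  shows "w x * exp (- (2 * t)) * (\<integral>v. indicator {-t..t} v * K v \<partial>lborel)
    \<le> (\<integral>u. w u * K (x + t - u) \<partial>lborel)"
proof -
  note [measurable] = K(1)
  have int': "integrable lborel (\<lambda>v. indicator {-t..t} v * K v)"
    by (rule Bochner_Integration.integrable_bound[OF K(3)]) (auto simp: indicator_def)
  have "(\<integral>v. indicator {-t..t} v * K v \<partial>lborel) = (\<integral>u. indicator {-t..t} (x + t - u) * K (x + t - u) \<partial>lborel)"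
    using lborel_integral_real_affine[of "-1" "\<lambda>v. indicator {-t..t} v * K v" "x + t"] by simp
  then have "w x * exp (- (2 * t)) * (\<integral>v. indicator {-t..t} v * K v \<partial>lborel)
      = (\<integral>u. w x * exp (- (2 * t)) * (indicator {-t..t} (x + t - u) * K (x + t - u)) \<partial>lborel)"
    by simp
  also have "\<dots> \<le> (\<integral>u. w u * K (x + t - u) \<partial>lborel)"
  proof (rule integral_mono[OF _ int])
    show "integrable lborel (\<lambda>u. w x * exp (- (2 * t)) * (indicator {-t..t} (x + t - u) * K (x + t - u)))"
      using lborel_integrable_real_affine[OF int', of "-1" "x + t"] by (intro integrable_mult_right) simp
    fix u
    show "w x * exp (- (2 * t)) * (indicator {-t..t} (x + t - u) * K (x + t - u)) \<le> w u * K (x + t - u)"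
    proof (cases "x + t - u \<in> {-t..t}")
      case True
      have "f x * exp (- x) * exp (- (2 * t)) = f x * exp (- (x + 2 * t))" by (simp add: exp_diff exp_minus field_simps exp_add)
      also have "\<dots> \<le> f u * exp (- u)"
        using True f by (intro mult_mono monoD[OF f(1)]) auto
      finally have "w x * exp (- (2 * t)) \<le> w u" using x True by (simp add: w_def)
      then show ?thesis using True K(2) by (simp add: mult_right_mono)
    qed (use f(2) K(2) in \<open>simp add: w_def\<close>)
  qed
  finally show ?thesis .
qed

text \<open>The kernel is now centred at \<open>x - t\<close>, so monotonicity bounds
  \<open>w\<close> above by \<open>w x * exp (2 * t)\<close> on the window
  \<open>[x - 2 t, x]\<close>. Outside the window no comparison with \<open>w x\<close> is
  available, and the majorant \<open>E\<close> takes over.\<close>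

lemma tauberian_kernel_lower:
  fixes f K :: "real \<Rightarrow> real"
  defines "w \<equiv> \<lambda>u. indicator {0..} u * (f u * exp (- u))"
  assumes f: "mono f" "\<And>u. 0 \<le> f u" and t: "0 < t"
    and K: "K \<in> borel_measurable borel" "\<And>v. 0 \<le> K v" "integrable lborel K"
    and int: "integrable lborel (\<lambda>u. w u * K (x - t - u))"
    and E: "\<And>u. w u \<le> E u" "integrable lborel (\<lambda>u. E u * (indicator {v. t < \<bar>v\<bar>} (x - t - u) * K (x - t - u)))"
    and x: "0 \<le> x"
  shows "(\<integral>u. w u * K (x - t - u) \<partial>lborel) \<le> w x * exp (2 * t) * integral\<^sup>L lborel K
    + (\<integral>u. E u * (indicator {v. t < \<bar>v\<bar>} (x - t - u) * K (x - t - u)) \<partial>lborel)"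
proof -
  have w0: "0 \<le> w u" for u using f(2) by (simp add: w_def)
  have int': "integrable lborel (\<lambda>u. K (x - t - u))"
    using lborel_integrable_real_affine[OF K(3), of "-1" "x - t"] by simp
  have eq: "integral\<^sup>L lborel K = (\<integral>u. K (x - t - u) \<partial>lborel)"
    using lborel_integral_real_affine[of "-1" K "x - t"] by simp
  have "(\<integral>u. w u * K (x - t - u) \<partial>lborel) \<le>
      (\<integral>u. w x * exp (2 * t) * K (x - t - u) + E u * (indicator {v. t < \<bar>v\<bar>} (x - t - u) * K (x - t - u)) \<partial>lborel)"
  proof (rule integral_mono[OF int])
    show "integrable lborel (\<lambda>u. w x * exp (2 * t) * K (x - t - u) + E u * (indicator {v. t < \<bar>v\<bar>} (x - t - u) * K (x - t - u)))"
      using E(2) int' by (intro Bochner_Integration.integrable_add integrable_mult_right)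
    fix u
    show "w u * K (x - t - u) \<le> w x * exp (2 * t) * K (x - t - u) + E u * (indicator {v. t < \<bar>v\<bar>} (x - t - u) * K (x - t - u))"
    proof (cases "t < \<bar>x - t - u\<bar>")
      case True
      have "w u * K (x - t - u) \<le> E u * K (x - t - u)" by (intro mult_right_mono E K)
      moreover have "0 \<le> w x * exp (2 * t) * K (x - t - u)" by (simp add: w0 K)
      ultimately show ?thesis using True by simp
    next
      case False
      have "w u \<le> w x * exp (2 * t)"
      proof (cases "0 \<le> u")
        case True
        have "f u * exp (- u) \<le> f x * exp (2 * t - x)"
          using False f by (intro mult_mono monoD[OF f(1)]) auto
        also have "\<dots> = f x * exp (- x) * exp (2 * t)" by (simp add: exp_diff exp_minus field_simps)
        finally show ?thesis using x True by (simp add: w_def)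
      qed (use w0 in \<open>simp add: w_def\<close>)
      then show ?thesis using False K(2) by (simp add: mult_right_mono)
    qed
  qed
  also have "\<dots> = w x * exp (2 * t) * integral\<^sup>L lborel K
    + (\<integral>u. E u * (indicator {v. t < \<bar>v\<bar>} (x - t - u) * K (x - t - u)) \<partial>lborel)"
    using E(2) int' unfolding eq by simp
  finally show ?thesis .
qed

text \<open>First the upper bound: at least \<open>1 - t\<close> of the mass of \<open>K\<close>
  lies in \<open>[-t, t]\<close>, so the limit superior is at most
  \<open>exp (2 * t) * B / (1 - t)\<close>. This yields a growth bound on \<open>w\<close>, hence a
  majorant \<open>E\<close> under which the tail of \<open>K\<close> costs at most
  \<open>(B + 1) * t\<close> in the lower bound. Then \<open>t\<close> tends to
  \<open>0\<close>.\<close>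

lemma tauberian_kernels:
  fixes f :: "real \<Rightarrow> real"
  defines "w \<equiv> \<lambda>u. indicator {0..} u * (f u * exp (- u))"
  assumes f: "mono f" "\<And>u. 0 \<le> f u" and \<alpha>: "0 < \<alpha>" and B: "0 \<le> B"
    and kernels: "\<And>t. 0 < t \<Longrightarrow> \<exists>K C N. K \<in> borel_measurable borel \<and> (\<forall>v. 0 \<le> K v) \<and>
      (\<forall>v. K v \<le> C * (1 + \<bar>v\<bar>) powr - N) \<and> \<alpha> + 3 \<le> N \<and> integral\<^sup>L lborel K = 1 \<and>
      (\<integral>v. indicator {v. t < \<bar>v\<bar>} v * K v \<partial>lborel) \<le> t \<and>
      (\<forall>x\<ge>1. integrable lborel (\<lambda>u. w u * K (x - u))) \<and>
      ((\<lambda>x. x powr (1 - \<alpha>) * (\<integral>u. w u * K (x - u) \<partial>lborel)) \<longlongrightarrow> B) at_top"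
  shows "((\<lambda>x. x powr (1 - \<alpha>) * w x) \<longlongrightarrow> B) at_top"
proof -
  have w0: "0 \<le> w u" for u using f(2) by (simp add: w_def)
  have upper: "\<forall>\<^sub>F x in at_top. x powr (1 - \<alpha>) * w x < D" if "B < D" for D
  proof -
    \<comment> \<open>The bound obtained from a kernel with parameter \<open>t\<close> tends to
      \<open>B\<close> as \<open>t\<close> decreases to \<open>0\<close>, so some \<open>t\<close>
      brings it below \<open>D\<close>.\<close>
    have "((\<lambda>t. exp (2 * t) * B / (1 - t)) \<longlongrightarrow> exp (2 * 0) * B / (1 - 0)) (at_right 0)"
      by (intro tendsto_intros) auto
    then have "\<forall>\<^sub>F t in at_right 0. exp (2 * t) * B / (1 - t) < D"
      using that by (auto dest: order_tendstoD)
    moreover have "\<forall>\<^sub>F t in at_right (0::real). 0 < t \<and> t < 1"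
      unfolding eventually_at_right_field by (intro exI[of _ 1]) auto
    ultimately have "\<forall>\<^sub>F t in at_right 0. exp (2 * t) * B / (1 - t) < D \<and> 0 < t \<and> t < 1"
      by eventually_elim auto
    then obtain t where t: "exp (2 * t) * B / (1 - t) < D" "0 < t" "t < 1"
      using eventually_happens trivial_limit_at_right_real by blast
    obtain K C N where K: "K \<in> borel_measurable borel" "\<And>v. 0 \<le> K v"
      "\<And>v. K v \<le> C * (1 + \<bar>v\<bar>) powr - N" "\<alpha> + 3 \<le> N" "integral\<^sup>L lborel K = 1"
      "(\<integral>v. indicator {v. t < \<bar>v\<bar>} v * K v \<partial>lborel) \<le> t"
      "\<And>x. 1 \<le> x \<Longrightarrow> integrable lborel (\<lambda>u. w u * K (x - u))"
      and lim: "((\<lambda>x. x powr (1 - \<alpha>) * (\<integral>u. w u * K (x - u) \<partial>lborel)) \<longlongrightarrow> B) at_top"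
      using kernels[OF t(2)] by blast
    note [measurable] = K(1)
    have K_int: "integrable lborel K"
      by (rule integrable_of_decay[where C = C and N = N]) (use K \<alpha> in auto)
    have split: "(\<integral>v. indicator {-t..t} v * K v \<partial>lborel) + (\<integral>v. indicator {v. t < \<bar>v\<bar>} v * K v \<partial>lborel) = 1"
    proof -
      have "(\<integral>v. indicator {-t..t} v * K v \<partial>lborel) + (\<integral>v. indicator {v. t < \<bar>v\<bar>} v * K v \<partial>lborel)
          = (\<integral>v. indicator {-t..t} v * K v + indicator {v. t < \<bar>v\<bar>} v * K v \<partial>lborel)"
        by (intro Bochner_Integration.integral_add[symmetric] Bochner_Integration.integrable_bound[OF K_int])
          (auto simp: indicator_def)
      also have "\<dots> = integral\<^sup>L lborel K"
        by (intro Bochner_Integration.integral_cong) (auto simp: indicator_def)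
      finally show ?thesis using K(5) by simp
    qed
    define I where "I y = (\<integral>u. w u * K (y - u) \<partial>lborel)" for y
    have "((\<lambda>x. x powr (1 - \<alpha>) * I (x + t)) \<longlongrightarrow> B) at_top"
      by (rule tendsto_powr_shift) (use lim in \<open>simp add: I_def\<close>)
    then have "((\<lambda>x. exp (2 * t) * (x powr (1 - \<alpha>) * I (x + t)) / (1 - t)) \<longlongrightarrow> exp (2 * t) * B / (1 - t)) at_top"
      by (intro tendsto_intros) (use t in auto)
    then have "\<forall>\<^sub>F x in at_top. exp (2 * t) * (x powr (1 - \<alpha>) * I (x + t)) / (1 - t) < D"
      using t(1) by (rule order_tendstoD)
    then show ?thesis
      using eventually_ge_at_top[of 1]
    proof eventually_elim
      case (elim x)
      have "w x * exp (- (2 * t)) * (1 - t) \<le> w x * exp (- (2 * t)) * (\<integral>v. indicator {-t..t} v * K v \<partial>lborel)"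
        using split K(6) w0 by (intro mult_left_mono) auto
      also have "\<dots> \<le> I (x + t)"
        unfolding w_def I_def
        by (rule tauberian_kernel_upper[OF f t(2) K(1,2) K_int])
          (use K(7)[of "x + t"] elim t in \<open>simp_all add: w_def\<close>)
      finally have "w x \<le> exp (2 * t) * I (x + t) / (1 - t)"
        using t by (simp add: exp_minus field_simps)
      then have "x powr (1 - \<alpha>) * w x \<le> x powr (1 - \<alpha>) * (exp (2 * t) * I (x + t) / (1 - t))"
        by (intro mult_left_mono) auto
      also have "\<dots> = exp (2 * t) * (x powr (1 - \<alpha>) * I (x + t)) / (1 - t)" by simp
      also have "\<dots> < D" by (rule elim)
      finally show ?case .
    qed
  qed
  \<comment> \<open>Being below \<open>1\<close>, \<open>\<beta>\<close> makes
    \<open>u powr (\<beta> - 1)\<close> decreasing, hence bounded below on \<open>(0, u0)\<close>;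
    being below \<open>\<alpha>\<close>, it contributes only lower order.\<close>
  define \<beta> where "\<beta> = min \<alpha> 1 / 2"
  have \<beta>: "0 < \<beta>" "\<beta> < \<alpha>" "\<beta> < 1" using \<alpha> by (auto simp: \<beta>_def)
  obtain u0 where u0: "1 \<le> u0" "\<And>u. u0 \<le> u \<Longrightarrow> u powr (1 - \<alpha>) * w u < B + 1"
  proof -
    obtain u1 where "\<And>u. u1 \<le> u \<Longrightarrow> u powr (1 - \<alpha>) * w u < B + 1"
      using upper[of "B + 1"] unfolding eventually_at_top_linorder by auto
    then show thesis by (intro that[of "max 1 u1"]) auto
  qed
  define C1 where "C1 = f u0 * u0 powr (1 - \<beta>)"
  \<comment> \<open>The first term majorises \<open>w\<close> beyond \<open>u0\<close>, the second
    on \<open>(0, u0)\<close> by the choice of \<open>C1\<close>. The third serves the point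
    \<open>0\<close>, where \<open>0 powr\<close> any exponent is \<open>0\<close> while
    \<open>w 0 = f 0\<close>.\<close>
  define E where "E u = (B + 1) * (indicator {0..} u * u powr (\<alpha> - 1)) + C1 * (indicator {0..} u * u powr (\<beta> - 1))
     + f 0 * indicator {0} u" for u :: real
  have wE: "w u \<le> E u" for u
  proof -
    consider "u < 0" | "u = 0" | "0 < u" "u < u0" | "u0 \<le> u" using u0(1) by linarith
    then show ?thesis
    proof cases
      case 3
      have "f u * exp (- u) \<le> f u0 * 1"
        using 3 f by (intro mult_mono monoD[OF f(1)]) auto
      also have "\<dots> \<le> f u0 * (u0 powr (1 - \<beta>) * u powr (\<beta> - 1))"
      proof (intro mult_left_mono f)
        have "u0 powr (\<beta> - 1) \<le> u powr (\<beta> - 1)" using 3 \<beta> by (intro powr_mono2') auto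
        then have "u0 powr (1 - \<beta>) * u0 powr (\<beta> - 1) \<le> u0 powr (1 - \<beta>) * u powr (\<beta> - 1)"
          by (intro mult_left_mono) auto
        then show "1 \<le> u0 powr (1 - \<beta>) * u powr (\<beta> - 1)"
          using u0(1) by (simp flip: powr_add)
      qed
      finally show ?thesis using 3 B by (simp add: E_def C1_def w_def mult.assoc add_increasing)
    next
      case 4
      then have u: "0 < u" using u0 by linarith
      have "w u = u powr (\<alpha> - 1) * (u powr (1 - \<alpha>) * w u)"
        using u by (simp flip: powr_add mult.assoc)
      also have "\<dots> \<le> u powr (\<alpha> - 1) * (B + 1)"
        using u0(2)[OF 4] by (intro mult_left_mono) auto
      finally have "w u \<le> (B + 1) * u powr (\<alpha> - 1)" by (simp add: mult.commute)
      moreover have "0 \<le> C1 * u powr (\<beta> - 1)" using f by (simp add: C1_def)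
      ultimately show ?thesis using u by (simp add: E_def)
    qed (auto simp: E_def w_def)
  qed
  have lower: "\<forall>\<^sub>F x in at_top. D < x powr (1 - \<alpha>) * w x" if "D < B" for D
  proof -
    \<comment> \<open>As \<open>t\<close> decreases to \<open>0\<close>, both the tail cost
      \<open>(B + 1) * t\<close> and the distortion \<open>exp (2 * t)\<close> disappear.\<close>
    have "((\<lambda>t. (B - (B + 1) * t) / exp (2 * t)) \<longlongrightarrow> (B - (B + 1) * 0) / exp (2 * 0)) (at_right 0)"
      by (intro tendsto_intros) auto
    then have "\<forall>\<^sub>F t in at_right 0. D < (B - (B + 1) * t) / exp (2 * t)"
      using that by (auto dest: order_tendstoD)
    moreover have "\<forall>\<^sub>F t in at_right (0::real). 0 < t"
      unfolding eventually_at_right_field by (intro exI[of _ 1]) auto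
    ultimately have "\<forall>\<^sub>F t in at_right 0. D < (B - (B + 1) * t) / exp (2 * t) \<and> 0 < t"
      by eventually_elim auto
    then obtain t where t: "D < (B - (B + 1) * t) / exp (2 * t)" "0 < t"
      using eventually_happens trivial_limit_at_right_real by blast
    obtain K C N where K: "K \<in> borel_measurable borel" "\<And>v. 0 \<le> K v"
      "\<And>v. K v \<le> C * (1 + \<bar>v\<bar>) powr - N" "\<alpha> + 3 \<le> N" "integral\<^sup>L lborel K = 1"
      "(\<integral>v. indicator {v. t < \<bar>v\<bar>} v * K v \<partial>lborel) \<le> t"
      "\<And>x. 1 \<le> x \<Longrightarrow> integrable lborel (\<lambda>u. w u * K (x - u))"
      and lim: "((\<lambda>x. x powr (1 - \<alpha>) * (\<integral>u. w u * K (x - u) \<partial>lborel)) \<longlongrightarrow> B) at_top"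
      using kernels[OF t(2)] by blast
    note [measurable] = K(1)
    have K_int: "integrable lborel K"
      by (rule integrable_of_decay[where C = C and N = N]) (use K \<alpha> in auto)
    define Kt where "Kt v = indicator {v. t < \<bar>v\<bar>} v * K v" for v
    have Kt_meas: "Kt \<in> borel_measurable borel" unfolding Kt_def by measurable
    have Kt: "\<bar>Kt v\<bar> \<le> C * (1 + \<bar>v\<bar>) powr - N" for v
      using K(2,3)[of v] by (auto simp: Kt_def indicator_def)
    have N: "\<bar>\<alpha> - 1\<bar> + 2 \<le> N" "\<bar>\<beta> - 1\<bar> + 2 \<le> N" using K(4) \<beta> \<alpha> by auto
    \<comment> \<open>The correction of \<open>E\<close> at the single point \<open>0\<close>
      vanishes almost everywhere, leaving two powers whose smoothings are known.\<close>
    have null: "AE u in lborel. E u * Kt (x - u) = (B + 1) * (indicator {0..} u * u powr (\<alpha> - 1) * Kt (x - u))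
        + C1 * (indicator {0..} u * u powr (\<beta> - 1) * Kt (x - u))" for x
      using AE_lborel_singleton[of 0] by eventually_elim (simp add: E_def algebra_simps)
    have [measurable]: "Kt \<in> borel_measurable borel" "E \<in> borel_measurable borel"
      using Kt_meas unfolding E_def[abs_def] by measurable
    have E_int: "integrable lborel (\<lambda>u. E u * Kt (x - u))" if "1 \<le> x" for x
      by (subst integrable_cong_AE[OF _ _ null])
        (auto intro!: integrable_powr_kernel[OF \<alpha> Kt_meas Kt N(1) that] integrable_powr_kernel[OF \<beta>(1) Kt_meas Kt N(2) that])
    define I where "I y = (\<integral>u. w u * K (y - u) \<partial>lborel)" for y
    define J where "J y = (\<integral>u. E u * Kt (y - u) \<partial>lborel)" for y
    have J_eq: "J x = (B + 1) * (\<integral>u. indicator {0..} u * u powr (\<alpha> - 1) * Kt (x - u) \<partial>lborel)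
        + C1 * (\<integral>u. indicator {0..} u * u powr (\<beta> - 1) * Kt (x - u) \<partial>lborel)" if "1 \<le> x" for x
      unfolding J_def
      by (subst integral_cong_AE[OF _ _ null])
        (auto simp: integrable_powr_kernel[OF \<alpha> Kt_meas Kt N(1) that] integrable_powr_kernel[OF \<beta>(1) Kt_meas Kt N(2) that])
    have "((\<lambda>x. (B + 1) * (x powr (1 - \<alpha>) * (\<integral>u. indicator {0..} u * u powr (\<alpha> - 1) * Kt (x - u) \<partial>lborel))
        + C1 * (x powr (1 - \<alpha>) * (\<integral>u. indicator {0..} u * u powr (\<beta> - 1) * Kt (x - u) \<partial>lborel)))
        \<longlongrightarrow> (B + 1) * integral\<^sup>L lborel Kt + C1 * 0) at_top"
      by (intro tendsto_intros tendsto_powr_kernel[OF \<alpha> Kt_meas Kt N(1)]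
          tendsto_lower_powr_kernel[OF \<beta>(1,2) Kt_meas Kt N(2)])
    moreover have "\<forall>\<^sub>F x in at_top. (B + 1) * (x powr (1 - \<alpha>) * (\<integral>u. indicator {0..} u * u powr (\<alpha> - 1) * Kt (x - u) \<partial>lborel))
        + C1 * (x powr (1 - \<alpha>) * (\<integral>u. indicator {0..} u * u powr (\<beta> - 1) * Kt (x - u) \<partial>lborel)) = x powr (1 - \<alpha>) * J x"
      using eventually_ge_at_top[of 1] by eventually_elim (simp add: J_eq distrib_left mult.left_commute)
    ultimately have J_lim: "((\<lambda>x. x powr (1 - \<alpha>) * J x) \<longlongrightarrow> (B + 1) * integral\<^sup>L lborel Kt) at_top"
      by (simp add: tendsto_cong)
    have "((\<lambda>x. (x powr (1 - \<alpha>) * I (x + (- t)) - x powr (1 - \<alpha>) * J (x + (- t))) / exp (2 * t))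
       \<longlongrightarrow> (B - (B + 1) * integral\<^sup>L lborel Kt) / exp (2 * t)) at_top"
      by (intro tendsto_divide tendsto_diff tendsto_const tendsto_powr_shift[OF lim[folded I_def]]
          tendsto_powr_shift[OF J_lim]) auto
    moreover have "D < (B - (B + 1) * integral\<^sup>L lborel Kt) / exp (2 * t)"
    proof -
      have "(B + 1) * integral\<^sup>L lborel Kt \<le> (B + 1) * t"
        using K(6) B by (intro mult_left_mono) (auto simp: Kt_def[abs_def])
      then have "(B - (B + 1) * t) / exp (2 * t) \<le> (B - (B + 1) * integral\<^sup>L lborel Kt) / exp (2 * t)"
        by (intro divide_right_mono) auto
      with t(1) show ?thesis by linarith
    qed
    ultimately have "\<forall>\<^sub>F x in at_top. D < (x powr (1 - \<alpha>) * I (x + (- t)) - x powr (1 - \<alpha>) * J (x + (- t))) / exp (2 * t)"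
      by (rule order_tendstoD)
    then show ?thesis
      using eventually_ge_at_top[of "1 + t"]
    proof eventually_elim
      case (elim x)
      have "I (x - t) \<le> w x * exp (2 * t) * integral\<^sup>L lborel K + J (x - t)"
        unfolding w_def I_def J_def Kt_def
        by (rule tauberian_kernel_lower[OF f t(2) K(1,2) K_int])
          (use K(7)[of "x - t"] E_int[of "x - t"] elim t wE in \<open>simp_all add: w_def Kt_def\<close>)
      then have "(I (x - t) - J (x - t)) / exp (2 * t) \<le> w x" using K(5) by (simp add: field_simps)
      then have "x powr (1 - \<alpha>) * ((I (x - t) - J (x - t)) / exp (2 * t)) \<le> x powr (1 - \<alpha>) * w x"
        by (intro mult_left_mono) auto
      with elim(1) show ?case by (simp add: right_diff_distrib)
    qed
  qed
  show ?thesis by (rule order_tendstoI) (use upper lower in auto)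
qed

section \<open>The boundary term\<close>

lemma (in prob_space) norm_integral_le_const:
  fixes g :: "'a \<Rightarrow> complex"
  assumes "AE t in M. norm (g t) \<le> C" "0 \<le> C"
  shows "norm (integral\<^sup>L M g) \<le> C"
\<comment> \<open>A non-integrable \<open>g\<close> has integral \<open>0\<close> by convention, and
  then \<open>0 \<le> C\<close> suffices.\<close>
proof (cases "integrable M g")
  case True
  have "norm (integral\<^sup>L M g) \<le> (\<integral>t. norm (g t) \<partial>M)" by (rule integral_norm_bound)
  also have "\<dots> \<le> (\<integral>t. C \<partial>M)" by (rule integral_mono_AE) (use True assms in auto)
  finally show ?thesis by (simp add: prob_space)
qed (simp add: not_integrable_integral_eq assms)

text \<open>Conditioning on the first \<open>n\<close> summands leaves one uniform variable, whose
  expectation is a plain integral over a window of length \<open>2 * l\<close> inside the support,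
  divided by \<open>2 * l\<close>. The outer average over \<open>s\<close> preserves the bound.
  Hence \<open>Suc n\<close>: at least one uniform summand is required.\<close>

lemma norm_integral_unif_sum_le:
  fixes \<phi> :: "real \<Rightarrow> complex"
  assumes l: "0 < l" and cont: "continuous_on UNIV \<phi>"
    and C: "\<And>a b. - (real (Suc n) * l) \<le> a \<Longrightarrow> a \<le> b \<Longrightarrow> b \<le> real (Suc n) * l \<Longrightarrow>
      norm (integral {a..b} (\<lambda>t. iexp (x * t) * \<phi> t)) \<le> C"
  shows "norm (\<integral>t. iexp (x * t) * \<phi> t \<partial>unif_sum l (Suc n)) \<le> C / (2 * l)"
proof -
  define L where "L = real (Suc n) * l"
  have L: "0 \<le> L" using l by (simp add: L_def)
  let ?U = "uniform_measure lborel {-l..l}"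
  \<comment> \<open>\<open>\<psi>\<close> clamps the argument to \<open>{-L..L}\<close>: it is
    globally bounded, as the convolution formula demands, and agrees with \<open>\<phi>\<close>
    almost everywhere.\<close>
  define \<psi> where "\<psi> t = \<phi> (max (- L) (min L t))" for t
  have cont\<psi>: "continuous_on S \<psi>" for S
    unfolding \<psi>_def by (intro continuous_on_compose2[OF cont] continuous_intros) auto
  have \<psi>: "\<psi> t = \<phi> t" if "\<bar>t\<bar> \<le> L" for t
  proof -
    have "max (- L) (min L t) = t" using that by linarith
    then show ?thesis by (simp add: \<psi>_def)
  qed
  obtain B where B: "\<And>t. t \<in> {-L..L} \<Longrightarrow> norm (\<phi> t) \<le> B"
    using continuous_norm_bound[OF cont] by blast
  have B\<psi>: "norm (\<psi> t) \<le> B" for t unfolding \<psi>_def using L by (intro B) auto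
  define E where "E t = iexp (x * t) * \<psi> t" for t
  have contE: "continuous_on S E" for S unfolding E_def by (intro continuous_intros cont\<psi>)
  have [measurable]: "\<phi> \<in> borel_measurable borel" "E \<in> borel_measurable borel"
    using cont contE by (auto intro: borel_measurable_continuous_onI)
  have C0: "0 \<le> C" using C[of 0 0] l by simp
  have scale: "norm (z /\<^sub>R (2 * l)) \<le> C / (2 * l)" if "norm z \<le> C" for z :: complex
    using that l by (simp add: field_simps)
  have "(\<integral>t. iexp (x * t) * \<phi> t \<partial>unif_sum l (Suc n)) = integral\<^sup>L (unif_sum l (Suc n)) E"
  proof (rule integral_cong_AE)
    show "AE t in unif_sum l (Suc n). iexp (x * t) * \<phi> t = E t"
      using AE_unif_sum[OF l, of "Suc n"] by eventually_elim (simp add: E_def \<psi> L_def)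
  qed (simp_all add: measurable_cong_sets[OF sets_unif_sum refl] del: unif_sum.simps)
  also have "\<dots> = (\<integral>s. \<integral>t. E (s + t) \<partial>?U \<partial>unif_sum l n)"
    unfolding unif_sum.simps
    by (rule integral_convolution[where B = B])
      (use l B\<psi> in \<open>auto simp: E_def norm_mult intro: prob_space_unif_sum prob_space_uniform_interval\<close>)
  finally have eq: "(\<integral>t. iexp (x * t) * \<phi> t \<partial>unif_sum l (Suc n)) = (\<integral>s. \<integral>t. E (s + t) \<partial>?U \<partial>unif_sum l n)" .
  interpret prob_space "unif_sum l n" using l by (rule prob_space_unif_sum)
  show ?thesis unfolding eq
  proof (rule norm_integral_le_const)
    show "0 \<le> C / (2 * l)" using C0 l by simp
    show "AE s in unif_sum l n. norm (\<integral>t. E (s + t) \<partial>?U) \<le> C / (2 * l)"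
      using AE_unif_sum[OF l, of n]
    proof eventually_elim
      case (elim s)
      have sL: "- L \<le> - l + s" "l + s \<le> L" using elim by (auto simp: L_def distrib_right)
      have "(\<integral>t. E (s + t) \<partial>?U) = integral {-l..l} (\<lambda>t. E (s + t)) /\<^sub>R (2 * l)"
        by (intro integral_uniform_interval l continuous_on_compose2[OF contE] continuous_intros) auto
      also have "integral {-l..l} (\<lambda>t. E (s + t)) = integral {-l + s..l + s} E"
        using integral_shift[of "-l" s l E] contE by (simp add: o_def add.commute)
      also have "\<dots> = integral {-l + s..l + s} (\<lambda>t. iexp (x * t) * \<phi> t)"
        by (intro Henstock_Kurzweil_Integration.integral_cong) (use sL \<psi> in \<open>auto simp: E_def abs_le_iff\<close>)
      also have "norm (\<dots> /\<^sub>R (2 * l)) \<le> C / (2 * l)"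
        by (rule scale, rule C) (use sL l in \<open>auto simp: L_def\<close>)
      finally show ?case .
    qed
  qed
qed

lemma tendsto_powr_integral_unif_sum:
  fixes \<phi> :: "real \<Rightarrow> complex"
  assumes l: "0 < l" and cont: "continuous_on UNIV \<phi>" and \<alpha>: "0 < \<alpha>"
    and bv: "\<alpha> < 1 \<Longrightarrow> locally_bounded_variation \<phi>"
  shows "((\<lambda>x. complex_of_real (x powr (1 - \<alpha>)) * (\<integral>t. iexp (x * t) * \<phi> t \<partial>unif_sum l (Suc n))) \<longlongrightarrow> 0) at_top"
proof (cases "\<alpha> < 1")
  case True
  have "0 \<le> real (Suc n) * l" using l by simp
  from riemann_lebesgue_bounded_variation[OF cont bv[OF True] this] obtain B where
    B: "\<And>x a b. pi \<le> x \<Longrightarrow> - (real (Suc n) * l) \<le> a \<Longrightarrow> a \<le> b \<Longrightarrow> b \<le> real (Suc n) * l \<Longrightarrow>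
      norm (integral {a..b} (\<lambda>t. iexp (x * t) * \<phi> t)) \<le> B / x" by blast
  show ?thesis
  proof (rule Lim_null_comparison)
    show "((\<lambda>x. B / (2 * l) * x powr - \<alpha>) \<longlongrightarrow> 0) at_top"
      using \<alpha> by (intro tendsto_mult_right_zero tendsto_neg_powr filterlim_ident) auto
    show "\<forall>\<^sub>F x in at_top. norm (complex_of_real (x powr (1 - \<alpha>)) * (\<integral>t. iexp (x * t) * \<phi> t \<partial>unif_sum l (Suc n)))
        \<le> B / (2 * l) * x powr - \<alpha>"
      using eventually_ge_at_top[of pi]
    proof eventually_elim
      case (elim x)
      have x: "0 < x" using elim pi_gt_zero by linarith
      have "norm (\<integral>t. iexp (x * t) * \<phi> t \<partial>unif_sum l (Suc n)) \<le> (B / x) / (2 * l)"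
        by (rule norm_integral_unif_sum_le[OF l cont]) (rule B[OF elim])
      then have "x powr (1 - \<alpha>) * norm (\<integral>t. iexp (x * t) * \<phi> t \<partial>unif_sum l (Suc n)) \<le> x powr (1 - \<alpha>) * ((B / x) / (2 * l))"
        by (intro mult_left_mono) auto
      also have "\<dots> = B / (2 * l) * x powr - \<alpha>"
        using x by (simp add: powr_diff powr_minus field_simps)
      finally show ?case by (simp add: norm_mult)
    qed
  qed
next
  case False
  show ?thesis
  proof (rule tendstoI)
    fix e :: real assume "0 < e"
    \<comment> \<open>The averaged bound divides by \<open>2 * l\<close>, so tolerance
      \<open>e * l\<close> for the windows results in \<open>e / 2\<close>.\<close>
    then have "0 < e * l" using l by simp
    from riemann_lebesgue_uniform[OF cont this, of "real (Suc n) * l"] obtain X where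
      X: "\<And>x a b. X \<le> x \<Longrightarrow> - (real (Suc n) * l) \<le> a \<Longrightarrow> a \<le> b \<Longrightarrow> b \<le> real (Suc n) * l \<Longrightarrow>
      norm (integral {a..b} (\<lambda>t. iexp (x * t) * \<phi> t)) \<le> e * l" by blast
    show "\<forall>\<^sub>F x in at_top. dist (complex_of_real (x powr (1 - \<alpha>)) * (\<integral>t. iexp (x * t) * \<phi> t \<partial>unif_sum l (Suc n))) 0 < e"
      using eventually_ge_at_top[of "max 1 X"]
    proof eventually_elim
      case (elim x)
      have "norm (\<integral>t. iexp (x * t) * \<phi> t \<partial>unif_sum l (Suc n)) \<le> e * l / (2 * l)"
        by (rule norm_integral_unif_sum_le[OF l cont]) (rule X, use elim in auto)
      moreover have "x powr (1 - \<alpha>) \<le> 1" using powr_mono[of "1 - \<alpha>" 0 x] elim False by simp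
      ultimately have "x powr (1 - \<alpha>) * norm (\<integral>t. iexp (x * t) * \<phi> t \<partial>unif_sum l (Suc n)) \<le> 1 * (e * l / (2 * l))"
        by (intro mult_mono) auto
      also have "\<dots> < e" using l \<open>0 < e\<close> by simp
      finally show ?case by (simp add: norm_mult)
    qed
  qed
qed

section \<open>Mass and concentration of the sinc kernels\<close>

text \<open>An even power is nonnegative, so a vanishing integral would force \<open>sinc\<close> to
  vanish almost everywhere, contrary to its positivity on \<open>(0, 1)\<close>. Positive mass
  permits normalisation.\<close>

lemma integral_sinc_power_pos:
  assumes "even m" "2 \<le> m"
  shows "integrable lborel (\<lambda>y. sinc y ^ m)" "0 < (\<integral>y. sinc y ^ m \<partial>lborel)"
proof -
  show int: "integrable lborel (\<lambda>y. sinc y ^ m)"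
  proof (rule integrable_of_decay)
    show "\<bar>sinc y ^ m\<bar> \<le> 2 ^ m * (1 + \<bar>y\<bar>) powr - real m" for y
      using sinc_power_decay[of 1 y m] unfolding mult_1_left by simp
  qed (use assms in auto)
  have nonneg: "0 \<le> sinc y ^ m" for y using assms(1) by (rule zero_le_even_power)
  have "(\<integral>y. sinc y ^ m \<partial>lborel) \<noteq> 0"
  proof
    assume "(\<integral>y. sinc y ^ m \<partial>lborel) = 0"
    then have "AE y in lborel. sinc y ^ m = 0"
      using integral_nonneg_eq_0_iff_AE[OF int] nonneg by simp
    then have "AE y in lborel. y \<notin> {0<..<1::real}"
    proof eventually_elim
      case (elim y)
      show ?case
      proof
        assume "y \<in> {0<..<1}"
        moreover from this have "0 < sin y" by (intro sin_gt_zero) (use pi_gt3 in auto)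
        ultimately show False using elim by simp
      qed
    qed
    then have "emeasure lborel {0<..<1::real} = 0"
      by (subst (asm) AE_iff_measurable[where N = "{0<..<1}"]) auto
    then show False by simp
  qed
  then show "0 < (\<integral>y. sinc y ^ m \<partial>lborel)"
    using integral_nonneg_AE[of "\<lambda>y. sinc y ^ m" lborel] nonneg by (simp add: less_le)
qed

text \<open>By the substitution \<open>y = l * v\<close>, the share of mass outside
  \<open>[-t, t]\<close> equals the share of \<open>S\<close> outside \<open>[- l t, l t]\<close>,
  which tends to \<open>0\<close> as \<open>l\<close> grows.\<close>

lemma kernel_concentration:
  fixes S :: "real \<Rightarrow> real"
  assumes S: "integrable lborel S" "\<And>y. 0 \<le> S y" "0 < integral\<^sup>L lborel S" and t: "0 < t"
  obtains l where "1 \<le> l" "0 < (\<integral>v. S (l * v) \<partial>lborel)"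
    "(\<integral>v. indicator {v. t < \<bar>v\<bar>} v * S (l * v) \<partial>lborel) \<le> t * (\<integral>v. S (l * v) \<partial>lborel)"
proof -
  define I where "I = integral\<^sup>L lborel S"
  have I: "0 < I" using S(3) by (simp add: I_def)
  have "((\<lambda>l. \<integral>y. indicator {y. l * t < \<bar>y\<bar>} y * S y \<partial>lborel) \<longlongrightarrow> (\<integral>y. 0 \<partial>(lborel :: real measure))) at_top"
  proof (rule integral_dominated_convergence_at_top[where w = S])
    show "AE y in lborel. ((\<lambda>l. indicator {y. l * t < \<bar>y\<bar>} y * S y) \<longlongrightarrow> 0) at_top"
    proof (rule AE_I2, rule tendsto_eventually)
      fix y :: real
      show "\<forall>\<^sub>F l in at_top. indicator {y. l * t < \<bar>y\<bar>} y * S y = 0"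
        using eventually_ge_at_top[of "\<bar>y\<bar> / t"] by eventually_elim (use t in \<open>simp add: field_simps\<close>)
    qed
    show "\<forall>\<^sub>F l in at_top. AE y in lborel. norm (indicator {y. l * t < \<bar>y\<bar>} y * S y) \<le> S y"
      using S(2) by (intro always_eventually allI AE_I2) (simp add: indicator_def)
  qed (use S in auto)
  then have "\<forall>\<^sub>F l in at_top. (\<integral>y. indicator {y. l * t < \<bar>y\<bar>} y * S y \<partial>lborel) < t * I"
    using t I by (intro order_tendstoD) auto
  then have "\<forall>\<^sub>F l in at_top. (\<integral>y. indicator {y. l * t < \<bar>y\<bar>} y * S y \<partial>lborel) < t * I \<and> 1 \<le> l"
    using eventually_ge_at_top[of 1] by eventually_elim auto
  then obtain l where l: "(\<integral>y. indicator {y. l * t < \<bar>y\<bar>} y * S y \<partial>lborel) < t * I" "1 \<le> l"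
    using eventually_happens trivial_limit_at_top_linorder by blast
  have 1: "(\<integral>v. S (l * v) \<partial>lborel) = I / l"
    using lborel_integral_real_affine[of l S 0] l by (simp add: I_def)
  have "l * (\<integral>v. indicator {v. t < \<bar>v\<bar>} v * S (l * v) \<partial>lborel)
      = l * (\<integral>v. indicator {y. l * t < \<bar>y\<bar>} (0 + l * v) * S (0 + l * v) \<partial>lborel)"
    using l by (simp add: indicator_def abs_mult)
  also have "\<dots> = (\<integral>y. indicator {y. l * t < \<bar>y\<bar>} y * S y \<partial>lborel)"
    using lborel_integral_real_affine[of l "\<lambda>y. indicator {y. l * t < \<bar>y\<bar>} y * S y" 0] l by simp
  also have "\<dots> \<le> t * I" using l by simp
  finally have 2: "(\<integral>v. indicator {v. t < \<bar>v\<bar>} v * S (l * v) \<partial>lborel) \<le> t * (I / l)"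
    using l by (simp add: field_simps)
  show thesis using that[of l] 1 2 l I by simp
qed

section \<open>Passage to the boundary line\<close>

text \<open>On the line \<open>Re z = \<sigma> n > 0\<close> the integrals converge absolutely and
  Parseval's formula applies. As \<open>\<sigma> n\<close> decreases to \<open>0\<close>, the terms
  with \<open>h\<close> and \<open>G\<close> converge by domination. The term with
  \<open>w \<ge> 0\<close> increases, so monotone convergence delivers its integrability together
  with its value.\<close>

lemma
  fixes w :: "real \<Rightarrow> real" and h :: "real \<Rightarrow> complex" and G :: "complex \<Rightarrow> complex" and x l :: real and m :: nat
  defines "K \<equiv> \<lambda>v. sinc (l * v) ^ m"
  assumes w: "\<And>u. 0 \<le> w u" "\<And>u. u < 0 \<Longrightarrow> w u = 0" "w \<in> borel_measurable borel"
    and h: "\<And>u. u < 0 \<Longrightarrow> h u = 0" "h \<in> borel_measurable borel"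
    and laplace: "\<And>z. 0 < Re z \<Longrightarrow>
      has_bochner_integral lborel (\<lambda>u. (of_real (w u) - h u) * exp (- (z * of_real u))) (G (1 + z))"
    and G: "continuous_on {s. 1 \<le> Re s} G"
    and m: "even m" and l: "0 < l"
    and hK: "integrable lborel (\<lambda>u. h u * of_real (K (x - u)))"
  shows integrable_smoothed: "integrable lborel (\<lambda>u. w u * K (x - u))"
    and integral_smoothed: "complex_of_real (\<integral>u. w u * K (x - u) \<partial>lborel) =
      (\<integral>u. h u * of_real (K (x - u)) \<partial>lborel) + (\<integral>t. iexp (x * t) * G (1 + \<i> * of_real t) \<partial>unif_sum l m)"
proof -
  interpret prob_space "unif_sum l m" using l by (rule prob_space_unif_sum)
  note w(3)[measurable] h(2)[measurable]
  have K_meas[measurable]: "K \<in> borel_measurable borel" unfolding K_def by measurable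
  have K0: "0 \<le> K v" for v unfolding K_def using m by (rule zero_le_even_power)
  have K1: "K v \<le> 1" for v
    using power_mono[OF abs_sinc_le_one[of "l * v"], of m] by (simp add: K_def power_abs[symmetric] abs_le_iff)
  \<comment> \<open>A decreasing null sequence in \<open>(0, 1]\<close>; the bound \<open>1\<close>
    keeps the lines within \<open>1 \<le> Re s \<le> 2\<close>.\<close>
  define \<sigma> where "\<sigma> n = inverse (real (Suc n))" for n
  have \<sigma>: "0 < \<sigma> n" "\<sigma> n \<le> 1" for n by (auto simp: \<sigma>_def field_simps)
  have \<sigma>_lim: "\<sigma> \<longlonglongrightarrow> 0" unfolding \<sigma>_def by (rule LIMSEQ_inverse_real_of_nat)
  define v where "v n u = (of_real (w u) - h u) * exp (- (of_real (\<sigma> n) * of_real u))" for n u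
  define R where "R n = (\<integral>t. iexp (x * t) * G (1 + (of_real (\<sigma> n) + \<i> * of_real t)) \<partial>unif_sum l m)" for n
  define R0 where "R0 = (\<integral>t. iexp (x * t) * G (1 + \<i> * of_real t) \<partial>unif_sum l m)"
  define H where "H n = (\<integral>u. h u * exp (- (of_real (\<sigma> n) * of_real u)) * of_real (K (x - u)) \<partial>lborel)" for n
  define H0 where "H0 = (\<integral>u. h u * of_real (K (x - u)) \<partial>lborel)"
  define X where "X n = (\<integral>u. w u * exp (- (\<sigma> n * u)) * K (x - u) \<partial>lborel)" for n
  have v_int: "integrable lborel (v n)" for n
    using laplace[of "of_real (\<sigma> n)"] \<sigma>[of n] unfolding v_def[abs_def] by (simp add: has_bochner_integral_iff)
  have vK: "integrable lborel (\<lambda>u. v n u * of_real (K (x - u)))"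
    and vK_eq: "(\<integral>u. v n u * of_real (K (x - u)) \<partial>lborel) = R n" for n
  proof -
    show "integrable lborel (\<lambda>u. v n u * of_real (K (x - u)))"
    proof (rule Bochner_Integration.integrable_bound[OF v_int[of n]])
      show "(\<lambda>u. v n u * of_real (K (x - u))) \<in> borel_measurable lborel"
        unfolding v_def by measurable
      show "AE u in lborel. norm (v n u * of_real (K (x - u))) \<le> norm (v n u)"
        using K0 K1 by (intro AE_I2) (simp add: norm_mult mult_left_le)
    qed
    have "(\<integral>u. v n u * of_real (K (x - u)) \<partial>lborel) = (\<integral>u. v n u * char (unif_sum l m) (x - u) \<partial>lborel)"
      unfolding char_unif_sum[OF l] K_def ..
    also have "\<dots> = (\<integral>t. iexp (x * t) * (\<integral>u. v n u * iexp (- (t * u)) \<partial>lborel) \<partial>unif_sum l m)"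
      by (rule integral_iexp_char) (use v_int prob_space_unif_sum[OF l] in auto)
    also have "(\<lambda>t. \<integral>u. v n u * iexp (- (t * u)) \<partial>lborel) = (\<lambda>t. G (1 + (of_real (\<sigma> n) + \<i> * of_real t)))"
    proof
      fix t
      have "v n u * iexp (- (t * u)) = (of_real (w u) - h u) * exp (- ((of_real (\<sigma> n) + \<i> * of_real t) * of_real u))" for u
        by (simp add: v_def algebra_simps flip: exp_add)
      then show "(\<integral>u. v n u * iexp (- (t * u)) \<partial>lborel) = G (1 + (of_real (\<sigma> n) + \<i> * of_real t))"
        using laplace[of "of_real (\<sigma> n) + \<i> * of_real t"] \<sigma>[of n] by (simp add: has_bochner_integral_iff)
    qed
    finally show "(\<integral>u. v n u * of_real (K (x - u)) \<partial>lborel) = R n" unfolding R_def .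
  qed
  have hle: "norm (h u * exp (- (of_real (\<sigma> n) * of_real u)) * of_real (K (x - u))) \<le> norm (h u * of_real (K (x - u)))" for n u
  proof (cases "u < 0")
    case False
    then have "norm (exp (- (complex_of_real (\<sigma> n) * of_real u))) \<le> 1" using \<sigma>[of n] by simp
    then have "norm (h u) * norm (exp (- (complex_of_real (\<sigma> n) * of_real u))) \<le> norm (h u)"
      by (intro mult_left_le) auto
    then show ?thesis unfolding norm_mult by (intro mult_right_mono) auto
  qed (simp add: h)
  have h_int: "integrable lborel (\<lambda>u. h u * exp (- (of_real (\<sigma> n) * of_real u)) * of_real (K (x - u)))" for n
    by (rule Bochner_Integration.integrable_bound[OF hK]) (use hle in auto)
  \<comment> \<open>Adding \<open>h\<close> back separates the damped \<open>w\<close> into a part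
    governed by \<open>G\<close> and a part governed by \<open>h\<close>, both integrable against
    \<open>K\<close>.\<close>
  have w_eq: "complex_of_real (w u * exp (- (\<sigma> n * u)) * K (x - u)) =
      v n u * of_real (K (x - u)) + h u * exp (- (of_real (\<sigma> n) * of_real u)) * of_real (K (x - u))" for n u
    by (simp add: v_def algebra_simps flip: exp_of_real)
  have w_int: "integrable lborel (\<lambda>u. w u * exp (- (\<sigma> n * u)) * K (x - u))" for n
  proof -
    have "integrable lborel (\<lambda>u. complex_of_real (w u * exp (- (\<sigma> n * u)) * K (x - u)))"
      unfolding w_eq by (intro Bochner_Integration.integrable_add vK h_int)
    then show ?thesis by (simp only: complex_of_real_integrable_eq)
  qed
  have X_eq: "complex_of_real (X n) = R n + H n" for n
  proof -
    have "complex_of_real (X n) = (\<integral>u. complex_of_real (w u * exp (- (\<sigma> n * u)) * K (x - u)) \<partial>lborel)"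
      unfolding X_def by (rule integral_complex_of_real[symmetric])
    also have "\<dots> = R n + H n"
      unfolding w_eq H_def vK_eq[symmetric] by (intro Bochner_Integration.integral_add vK h_int)
    finally show ?thesis .
  qed
  have H_lim: "H \<longlonglongrightarrow> H0"
    unfolding H_def H0_def
  proof (rule integral_dominated_convergence[where w = "\<lambda>u. norm (h u * of_real (K (x - u)))"])
    show "AE u in lborel. (\<lambda>n. h u * exp (- (of_real (\<sigma> n) * of_real u)) * of_real (K (x - u))) \<longlonglongrightarrow> h u * of_real (K (x - u))"
    proof (rule AE_I2)
      fix u
      have "(\<lambda>n. h u * exp (- (of_real (\<sigma> n) * of_real u)) * of_real (K (x - u))) \<longlonglongrightarrow>
        h u * exp (- (of_real 0 * of_real u)) * of_real (K (x - u))"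
        by (intro tendsto_intros \<sigma>_lim)
      then show "(\<lambda>n. h u * exp (- (of_real (\<sigma> n) * of_real u)) * of_real (K (x - u))) \<longlonglongrightarrow> h u * of_real (K (x - u))" by simp
    qed
  qed (use hK hle in auto)
  define L where "L = real m * l"
  \<comment> \<open>\<open>unif_sum l m\<close> lives on \<open>{-L..L}\<close>, so this rectangle
    almost surely contains every argument at which \<open>G\<close> is evaluated; the bound
    \<open>C\<close> is integrable for a probability measure.\<close>
  have "compact (G ` cbox (Complex 1 (- L)) (Complex 2 L))"
    by (intro compact_continuous_image continuous_on_subset[OF G] compact_cbox) (auto simp: in_cbox_complex_iff)
  then obtain C where C: "\<And>z. z \<in> cbox (Complex 1 (- L)) (Complex 2 L) \<Longrightarrow> norm (G z) \<le> C"
    using compact_imp_bounded[of "G ` cbox (Complex 1 (- L)) (Complex 2 L)"] unfolding bounded_iff by blast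
  have G_cont: "continuous_on UNIV (\<lambda>t. G (1 + (of_real s + \<i> * of_real t)))" if "0 \<le> s" for s
    by (rule continuous_on_compose2[OF G]) (use that in \<open>auto intro!: continuous_intros\<close>)
  have G_meas: "(\<lambda>t. iexp (x * t) * G (1 + (of_real s + \<i> * of_real t))) \<in> borel_measurable (unif_sum l m)" if "0 \<le> s" for s
    unfolding measurable_cong_sets[OF sets_unif_sum refl]
    by (intro borel_measurable_continuous_onI continuous_intros G_cont that)
  have R_lim: "R \<longlonglongrightarrow> R0"
    unfolding R_def R0_def
  proof (rule integral_dominated_convergence[where w = "\<lambda>_. C"])
    show "(\<lambda>t. iexp (x * t) * G (1 + \<i> * of_real t)) \<in> borel_measurable (unif_sum l m)"
      using G_meas[of 0] by simp
    show "(\<lambda>t. iexp (x * t) * G (1 + (of_real (\<sigma> n) + \<i> * of_real t))) \<in> borel_measurable (unif_sum l m)" for n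
      using \<sigma>[of n] by (intro G_meas) auto
    show "AE t in unif_sum l m. (\<lambda>n. iexp (x * t) * G (1 + (of_real (\<sigma> n) + \<i> * of_real t))) \<longlonglongrightarrow> iexp (x * t) * G (1 + \<i> * of_real t)"
    proof (rule AE_I2)
      fix t
      have "(\<lambda>n. 1 + (of_real (\<sigma> n) + \<i> * of_real t)) \<longlonglongrightarrow> 1 + (of_real 0 + \<i> * complex_of_real t)"
        by (intro tendsto_intros \<sigma>_lim)
      then have "(\<lambda>n. G (1 + (of_real (\<sigma> n) + \<i> * of_real t))) \<longlonglongrightarrow> G (1 + (of_real 0 + \<i> * of_real t))"
        by (rule continuous_on_tendsto_compose[OF G]) (use \<sigma> in \<open>auto intro!: always_eventually less_imp_le\<close>)
      then show "(\<lambda>n. iexp (x * t) * G (1 + (of_real (\<sigma> n) + \<i> * of_real t))) \<longlonglongrightarrow> iexp (x * t) * G (1 + \<i> * of_real t)"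
        by (intro tendsto_intros) simp
    qed
    show "AE t in unif_sum l m. norm (iexp (x * t) * G (1 + (of_real (\<sigma> n) + \<i> * of_real t))) \<le> C" for n
      using AE_unif_sum[OF l, of m]
    proof eventually_elim
      case (elim t)
      have "norm (G (1 + (of_real (\<sigma> n) + \<i> * of_real t))) \<le> C"
        by (rule C) (use \<sigma>[of n] elim in \<open>auto simp: in_cbox_complex_iff L_def abs_le_iff\<close>)
      then show ?case by (simp add: norm_mult)
    qed
  qed auto
  have X_lim: "(\<lambda>n. complex_of_real (X n)) \<longlonglongrightarrow> R0 + H0"
    unfolding X_eq by (intro tendsto_add R_lim H_lim)
  then have "X \<longlonglongrightarrow> Re (R0 + H0)" using tendsto_Re by fastforce
  then have lim: "(\<lambda>n. \<integral>u. w u * exp (- (\<sigma> n * u)) * K (x - u) \<partial>lborel) \<longlonglongrightarrow> Re (R0 + H0)"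
    unfolding X_def .
  \<comment> \<open>The damping factor increases with \<open>n\<close> only where
    \<open>0 \<le> u\<close>; for negative \<open>u\<close> the function \<open>w\<close>
    vanishes.\<close>
  have mono: "mono (\<lambda>n. w u * exp (- (\<sigma> n * u)) * K (x - u))" for u
  proof (rule monoI)
    fix i j :: nat assume "i \<le> j"
    then have "\<sigma> j \<le> \<sigma> i" by (simp add: \<sigma>_def le_imp_inverse_le)
    then have "exp (- (\<sigma> i * u)) \<le> exp (- (\<sigma> j * u))" if "0 \<le> u" using that by (simp add: mult_right_mono)
    then show "w u * exp (- (\<sigma> i * u)) * K (x - u) \<le> w u * exp (- (\<sigma> j * u)) * K (x - u)"
      using w(1,2)[of u] K0 by (cases "u < 0") (auto intro!: mult_right_mono mult_left_mono)
  qed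
  have conv: "(\<lambda>n. w u * exp (- (\<sigma> n * u)) * K (x - u)) \<longlonglongrightarrow> w u * K (x - u)" for u
  proof -
    have "(\<lambda>n. w u * exp (- (\<sigma> n * u)) * K (x - u)) \<longlonglongrightarrow> w u * exp (- (0 * u)) * K (x - u)"
      by (intro tendsto_intros \<sigma>_lim)
    then show ?thesis by simp
  qed
  have meas: "(\<lambda>u. w u * K (x - u)) \<in> borel_measurable lborel" by measurable
  show int: "integrable lborel (\<lambda>u. w u * K (x - u))"
    by (rule integrable_monotone_convergence[OF w_int _ _ lim meas]) (use mono conv in auto)
  have eq: "(\<integral>u. w u * K (x - u) \<partial>lborel) = Re (R0 + H0)"
    by (rule integral_monotone_convergence[OF w_int _ _ lim meas]) (use mono conv in auto)
  have "(\<lambda>n. complex_of_real (X n)) \<longlonglongrightarrow> of_real (Re (R0 + H0))"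
    using \<open>X \<longlonglongrightarrow> Re (R0 + H0)\<close> by (rule tendsto_of_real)
  \<comment> \<open>The complex limit is a limit of real numbers, hence equal to its real
    part.\<close>
  with X_lim have "of_real (Re (R0 + H0)) = R0 + H0" by (rule LIMSEQ_unique[THEN sym])
  then show "complex_of_real (\<integral>u. w u * K (x - u) \<partial>lborel) =
      (\<integral>u. h u * of_real (K (x - u)) \<partial>lborel) + (\<integral>t. iexp (x * t) * G (1 + \<i> * of_real t) \<partial>unif_sum l m)"
    unfolding eq by (simp add: R0_def H0_def)
qed

section \<open>Choice of kernels and verification of the Tauberian hypotheses\<close>

(* For complex z \<noteq> 0 and real \<beta>, z powr of_real \<beta> is exp (of_real \<beta> * Ln z), with Ln the
   principal branch. The variable G denotes the function after its continuous extension to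
   Re s \<ge> 1; that extension is unique. *)
theorem theorem2p1:
  fixes f :: "real \<Rightarrow> real" and r :: nat
    and \<alpha> A :: real and \<alpha>s :: "nat \<Rightarrow> real" and As :: "nat \<Rightarrow> complex"
    and G :: "complex \<Rightarrow> complex"
  assumes f_nonneg: "\<And>u. 0 \<le> f u"
    and f_mono: "mono f"
    and F_conv: "\<And>s. 1 < Re s \<Longrightarrow> laplace_abs_convergent f s"
    and \<alpha>_pos: "0 < \<alpha>"
    and \<alpha>s_pos: "\<And>i. i \<in> {1..r} \<Longrightarrow> 0 < \<alpha>s i"
    and A_pos: "0 < A"
    and \<alpha>s_less: "\<And>i. i \<in> {1..r} \<Longrightarrow> \<alpha>s i < \<alpha>"
    and G_eq: "\<And>s. 1 < Re s \<Longrightarrow>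
      G s = laplace_transform f s - complex_of_real A / (s - 1) powr complex_of_real \<alpha>
            - (\<Sum>i=1..r. As i / (s - 1) powr complex_of_real (\<alpha>s i))"
    and G_cont: "continuous_on {s. 1 \<le> Re s} G"
    and G_bv: "\<alpha> < 1 \<Longrightarrow> locally_bounded_variation (\<lambda>t. G (1 + \<i> * complex_of_real t))"
  shows "((\<lambda>u. u powr (1 - \<alpha>) * exp (- u) * f u) \<longlongrightarrow> A / Gamma \<alpha>) at_top"
proof -
  define w where "w u = indicator {0..} u * (f u * exp (- u))" for u :: real
  define p where "p \<beta> u = indicator {0..} u * u powr (\<beta> - 1)" for \<beta> u :: real
  define c where "c i = As i / complex_of_real (Gamma (\<alpha>s i))" for i
  define B where "B = A / Gamma \<alpha>"
  \<comment> \<open>Dividing each coefficient by its Gamma value makes the Laplace transform of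
    \<open>h\<close> equal to the singular part subtracted in \<open>G\<close>.\<close>
  define h where "h u = complex_of_real B * of_real (p \<alpha> u) + (\<Sum>i=1..r. c i * of_real (p (\<alpha>s i) u))" for u
  have B: "0 \<le> B" using A_pos Gamma_real_pos[OF \<alpha>_pos] by (simp add: B_def)
  have [measurable]: "f \<in> borel_measurable borel" using f_mono by (rule borel_measurable_mono)
  have w: "0 \<le> w u" "u < 0 \<Longrightarrow> w u = 0" for u using f_nonneg by (auto simp: w_def)
  have w_meas: "w \<in> borel_measurable borel" unfolding w_def by measurable
  have p_meas[measurable]: "p \<beta> \<in> borel_measurable borel" for \<beta> unfolding p_def by measurable
  have h_meas: "h \<in> borel_measurable borel" unfolding h_def by measurable
  have h_neg: "u < 0 \<Longrightarrow> h u = 0" for u by (simp add: h_def p_def)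
  have p_lap: "has_bochner_integral lborel (\<lambda>u. d * of_real (p \<beta> u) * exp (- (z * of_real u))) (d * (Gamma \<beta> / z powr \<beta>))"
    if "0 < \<beta>" "0 < Re z" for d z \<beta>
    unfolding p_def mult.assoc[of d]
    by (intro has_bochner_integral_mult_right has_bochner_integral_laplace_powr that)
  have laplace: "has_bochner_integral lborel (\<lambda>u. (of_real (w u) - h u) * exp (- (z * of_real u))) (G (1 + z))"
    if z: "0 < Re z" for z
  proof -
    have "set_integrable lborel {0..} (\<lambda>u. complex_of_real (f u) * exp (- (1 + z) * of_real u))"
      using F_conv[of "1 + z"] z by (simp add: laplace_abs_convergent_def)
    then have "has_bochner_integral lborel (\<lambda>u. indicator {0..} u *\<^sub>R (complex_of_real (f u) * exp (- (1 + z) * of_real u)))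
        (laplace_transform f (1 + z))"
      unfolding set_integrable_def laplace_transform_def set_lebesgue_integral_def by (rule has_bochner_integral_integrable)
    also have "(\<lambda>u. indicator {0..} u *\<^sub>R (complex_of_real (f u) * exp (- (1 + z) * of_real u)))
        = (\<lambda>u. of_real (w u) * exp (- (z * of_real u)))"
      by (auto simp: w_def indicator_def algebra_simps exp_of_real[symmetric] simp flip: exp_add)
    finally have 1: "has_bochner_integral lborel (\<lambda>u. of_real (w u) * exp (- (z * of_real u))) (laplace_transform f (1 + z))" .
    have 2: "has_bochner_integral lborel (\<lambda>u. of_real B * of_real (p \<alpha> u) * exp (- (z * of_real u))) (A / z powr \<alpha>)"
      using p_lap[OF \<alpha>_pos z, of "of_real B"] Gamma_real_pos[OF \<alpha>_pos] by (simp add: B_def)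
    have 3: "has_bochner_integral lborel (\<lambda>u. c i * of_real (p (\<alpha>s i) u) * exp (- (z * of_real u))) (As i / z powr \<alpha>s i)"
      if "i \<in> {1..r}" for i
      using p_lap[OF \<alpha>s_pos[OF that] z, of "c i"] Gamma_real_pos[OF \<alpha>s_pos[OF that]] by (simp add: c_def)
    have "has_bochner_integral lborel (\<lambda>u. of_real (w u) * exp (- (z * of_real u))
        - of_real B * of_real (p \<alpha> u) * exp (- (z * of_real u))
        - (\<Sum>i=1..r. c i * of_real (p (\<alpha>s i) u) * exp (- (z * of_real u))))
        (laplace_transform f (1 + z) - A / z powr \<alpha> - (\<Sum>i=1..r. As i / z powr \<alpha>s i))"
      by (intro has_bochner_integral_diff has_bochner_integral_sum 1 2 3)
    also have "(laplace_transform f (1 + z) - A / z powr \<alpha> - (\<Sum>i=1..r. As i / z powr \<alpha>s i)) = G (1 + z)"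
      using G_eq[of "1 + z"] z by simp
    finally show ?thesis by (simp add: h_def ring_distribs sum_distrib_right diff_diff_eq)
  qed
  have \<phi>_cont: "continuous_on UNIV (\<lambda>t. G (1 + \<i> * complex_of_real t))"
    by (rule continuous_on_compose2[OF G_cont]) (auto intro!: continuous_intros)
  \<comment> \<open>\<open>m\<close> is even to make the kernel nonnegative, and at least
    \<open>\<alpha> + 3\<close> to supply the decay for every power
    \<open>\<beta> \<le> \<alpha>\<close>.\<close>
  define m where "m = 2 * nat \<lceil>\<alpha> + 3\<rceil>"
  have m: "even m" "\<alpha> + 3 \<le> real m" "2 \<le> m" using \<alpha>_pos unfolding m_def by (auto, linarith+)
  \<comment> \<open>The boundary estimate requires at least one uniform summand, hence
    \<open>m\<close> as a successor.\<close>
  then obtain m' where m': "m = Suc m'" by (cases m) auto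
  define S where "S v = sinc v ^ m" for v :: real
  have S: "integrable lborel S" "0 < integral\<^sup>L lborel S"
    unfolding S_def using integral_sinc_power_pos[OF m(1,3)] by auto
  have S0: "0 \<le> S v" for v unfolding S_def using m(1) by (rule zero_le_even_power)
  have S_meas[measurable]: "S \<in> borel_measurable borel" using S(1) by auto
  have "((\<lambda>x. x powr (1 - \<alpha>) * w x) \<longlongrightarrow> B) at_top"
    unfolding w_def
  proof (rule tauberian_kernels[OF f_mono f_nonneg \<alpha>_pos B], fold w_def)
    fix t :: real assume "0 < t"
    then obtain l where l: "1 \<le> l" and I: "0 < (\<integral>v. S (l * v) \<partial>lborel)"
      and conc: "(\<integral>v. indicator {v. t < \<bar>v\<bar>} v * S (l * v) \<partial>lborel) \<le> t * (\<integral>v. S (l * v) \<partial>lborel)"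
      using kernel_concentration[OF S(1) S0 S(2)] by blast
    define I where "I = (\<integral>v. S (l * v) \<partial>lborel)"
    define K where "K v = S (l * v)" for v
    have K_meas: "K \<in> borel_measurable borel" unfolding K_def by measurable
    have decay: "\<bar>K v\<bar> \<le> 2 ^ m * (1 + \<bar>v\<bar>) powr - real m" for v
      unfolding K_def S_def by (rule sinc_power_decay[OF l])
    have N: "\<bar>\<beta> - 1\<bar> + 2 \<le> real m" if "0 < \<beta>" "\<beta> \<le> \<alpha>" for \<beta>
      using that m(2) by linarith
    define P where "P \<beta> x = (\<integral>u. p \<beta> u * K (x - u) \<partial>lborel)" for \<beta> x
    have pK_int: "integrable lborel (\<lambda>u. p \<beta> u * K (x - u))" if "0 < \<beta>" "\<beta> \<le> \<alpha>" "1 \<le> x" for \<beta> x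
      unfolding p_def by (rule integrable_powr_kernel[OF that(1) K_meas decay N[OF that(1,2)] that(3)])
    have hK: "has_bochner_integral lborel (\<lambda>u. h u * of_real (K (x - u)))
        (of_real B * of_real (P \<alpha> x) + (\<Sum>i=1..r. c i * of_real (P (\<alpha>s i) x)))" if "1 \<le> x" for x
    proof -
      have 1: "has_bochner_integral lborel (\<lambda>u. d * complex_of_real (p \<beta> u * K (x - u))) (d * of_real (P \<beta> x))"
        if "0 < \<beta>" "\<beta> \<le> \<alpha>" for \<beta> d
        unfolding P_def
        by (intro has_bochner_integral_mult_right has_bochner_integral_of_real has_bochner_integral_integrable pK_int that \<open>1 \<le> x\<close>)
      have "has_bochner_integral lborel (\<lambda>u. of_real B * of_real (p \<alpha> u * K (x - u)) + (\<Sum>i=1..r. c i * of_real (p (\<alpha>s i) u * K (x - u))))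
        (of_real B * of_real (P \<alpha> x) + (\<Sum>i=1..r. c i * of_real (P (\<alpha>s i) x)))"
        using \<alpha>_pos \<alpha>s_pos \<alpha>s_less
        by (intro has_bochner_integral_add has_bochner_integral_sum 1) (auto intro: less_imp_le)
      then show ?thesis by (simp add: h_def ring_distribs sum_distrib_right mult.assoc)
    qed
    define R where "R x = (\<integral>t. iexp (x * t) * G (1 + \<i> * of_real t) \<partial>unif_sum l m)" for x
    have l0: "0 < l" using l by simp
    have wK_int: "integrable lborel (\<lambda>u. w u * K (x - u))" if "1 \<le> x" for x
      using integrable_smoothed[OF w w_meas h_neg h_meas laplace G_cont m(1) l0] hK[OF that]
      by (simp add: K_def S_def has_bochner_integral_iff)
    have wK_eq: "complex_of_real (\<integral>u. w u * K (x - u) \<partial>lborel) =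
        of_real B * of_real (P \<alpha> x) + (\<Sum>i=1..r. c i * of_real (P (\<alpha>s i) x)) + R x" if "1 \<le> x" for x
      using integral_smoothed[OF w w_meas h_neg h_meas laplace G_cont m(1) l0] hK[OF that]
      by (simp add: K_def S_def has_bochner_integral_iff R_def)
    have P_lim: "((\<lambda>x. x powr (1 - \<alpha>) * P \<alpha> x) \<longlongrightarrow> I) at_top"
      using tendsto_powr_kernel[OF \<alpha>_pos K_meas decay N[OF \<alpha>_pos order_refl]]
      by (simp add: P_def p_def I_def K_def)
    have P_lim0: "((\<lambda>x. x powr (1 - \<alpha>) * P (\<alpha>s i) x) \<longlongrightarrow> 0) at_top" if "i \<in> {1..r}" for i
      using tendsto_lower_powr_kernel[OF \<alpha>s_pos[OF that] \<alpha>s_less[OF that] K_meas decay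
          N[OF \<alpha>s_pos[OF that] less_imp_le[OF \<alpha>s_less[OF that]]]]
      by (simp add: P_def p_def)
    have R_lim: "((\<lambda>x. complex_of_real (x powr (1 - \<alpha>)) * R x) \<longlongrightarrow> 0) at_top"
      unfolding R_def m' by (rule tendsto_powr_integral_unif_sum[OF l0 \<phi>_cont \<alpha>_pos G_bv])
    \<comment> \<open>Only the leading power survives: the lower powers and the boundary term
      \<open>R\<close> tend to \<open>0\<close>, leaving \<open>B\<close> times the kernel mass
      \<open>I\<close>.\<close>
    have "((\<lambda>x. of_real B * complex_of_real (x powr (1 - \<alpha>) * P \<alpha> x)
        + (\<Sum>i=1..r. c i * complex_of_real (x powr (1 - \<alpha>) * P (\<alpha>s i) x))
        + complex_of_real (x powr (1 - \<alpha>)) * R x) \<longlongrightarrow> of_real B * of_real I + (\<Sum>i=1..r. c i * of_real 0) + 0) at_top"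
      by (intro tendsto_add tendsto_sum tendsto_mult tendsto_const tendsto_of_real P_lim P_lim0 R_lim)
    moreover have "\<forall>\<^sub>F x in at_top. of_real B * complex_of_real (x powr (1 - \<alpha>) * P \<alpha> x)
        + (\<Sum>i=1..r. c i * complex_of_real (x powr (1 - \<alpha>) * P (\<alpha>s i) x))
        + complex_of_real (x powr (1 - \<alpha>)) * R x
        = complex_of_real (x powr (1 - \<alpha>) * (\<integral>u. w u * K (x - u) \<partial>lborel))"
      using eventually_ge_at_top[of 1]
      by eventually_elim (simp only: of_real_mult wK_eq ring_distribs sum_distrib_left mult.left_commute)
    ultimately have "((\<lambda>x. complex_of_real (x powr (1 - \<alpha>) * (\<integral>u. w u * K (x - u) \<partial>lborel))) \<longlongrightarrow> of_real (B * I)) at_top"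
      by (simp add: tendsto_cong)
    then have wK_lim: "((\<lambda>x. x powr (1 - \<alpha>) * (\<integral>u. w u * K (x - u) \<partial>lborel)) \<longlongrightarrow> B * I) at_top"
      by (simp only: tendsto_of_real_iff)
    have I0: "0 < I" using I by (simp add: I_def)
    \<comment> \<open>The witness is the kernel divided by its mass \<open>I\<close>, so that its
      integral is \<open>1\<close> and the limit \<open>B * I\<close> becomes \<open>B\<close>;
      \<open>conc\<close> turns into the tail bound \<open>t\<close>.\<close>
    show "\<exists>K C N. K \<in> borel_measurable borel \<and> (\<forall>v. 0 \<le> K v) \<and>
      (\<forall>v. K v \<le> C * (1 + \<bar>v\<bar>) powr - N) \<and> \<alpha> + 3 \<le> N \<and> integral\<^sup>L lborel K = 1 \<and>
      (\<integral>v. indicator {v. t < \<bar>v\<bar>} v * K v \<partial>lborel) \<le> t \<and>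
      (\<forall>x\<ge>1. integrable lborel (\<lambda>u. w u * K (x - u))) \<and>
      ((\<lambda>x. x powr (1 - \<alpha>) * (\<integral>u. w u * K (x - u) \<partial>lborel)) \<longlongrightarrow> B) at_top"
    proof (intro exI conjI allI impI)
      show "(\<lambda>v. K v / I) \<in> borel_measurable borel" using K_meas by measurable
      show "0 \<le> K v / I" for v using S0 I0 by (simp add: K_def)
      show "K v / I \<le> 2 ^ m / I * (1 + \<bar>v\<bar>) powr - real m" for v
        using decay[of v] I0 by (simp add: divide_right_mono)
      show "\<alpha> + 3 \<le> real m" by (rule m)
      show "(\<integral>v. K v / I \<partial>lborel) = 1" using I0 by (simp add: K_def I_def)
      show "(\<integral>v. indicator {v. t < \<bar>v\<bar>} v * (K v / I) \<partial>lborel) \<le> t"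
        using conc I0 by (simp add: K_def I_def[symmetric] pos_divide_le_eq)
      show "integrable lborel (\<lambda>u. w u * (K (x - u) / I))" if "1 \<le> x" for x
        using wK_int[OF that] by simp
      show "((\<lambda>x. x powr (1 - \<alpha>) * (\<integral>u. w u * (K (x - u) / I) \<partial>lborel)) \<longlongrightarrow> B) at_top"
        using tendsto_divide[OF wK_lim tendsto_const, of I] I0 by simp
    qed
  qed
  moreover have "\<forall>\<^sub>F x in at_top. x powr (1 - \<alpha>) * w x = x powr (1 - \<alpha>) * exp (- x) * f x"
    using eventually_ge_at_top[of 0] by eventually_elim (simp add: w_def)
  ultimately show ?thesis by (simp add: tendsto_cong B_def)
qed

end
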